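(* The problem Swap Bribery for $k$-approval (with $k$ part of the input), restricted to instances in which every swap has cost exactly $1$, is solvable in polynomial time. That is, there is a polynomial-time algorithm which, given a finite set $C$ of candidates, a finite list $V$ of votes (strict linear orders over $C$), an integer $k$, a preferred candidate $p\in C$, and a budget $\beta\in\mathbb{N}$, decides whether there is an admissible set $\Gamma$ of swaps of total cost at most $\beta$ (all swaps having cost $1$) such that $p$ is a winner of the $k$-approval election $(C,V^{\Gamma})$.
   Context: Elections. An election consists of a set $C=\{c_1,\dots,c_m\}$ of candidates and votes $V=\{v_1,\dots,v_n\}$; each vote is a strict linear order over $C$ (several voters may have the same order), and $\mathrm{rank}(c,v)$ is the position of $c$ in $v$ (position $1$ is best). In $k$-approval, a candidate $c$ receives one point from $v$ if $\mathrm{rank}(c,v)\le k$ and zero points otherwise; the winners are all candidates with the highest total number of points (ties are allowed, so there may be several winners). Swaps. A swap in a vote $v$ is a triple $(v,a,b)$ with $a,b\in C$, $a\ne b$. It is admissible in $v$ if $\mathrm{rank}(a,v)=\mathrm{rank}(b,v)-1$; applying it exchanges the positions of $a$ and $b$ in $v$. A set $\Gamma$ of swaps is admissible in $v$ if its elements can be applied to $v$ one after the other in some order, each being admissible in the vote obtained so far; the resulting vote is $v^{\Gamma}$. This extends vote by vote to several votes, the resulting votes being denoted $V^{\Gamma}$. Swap Bribery for an election system $\mathcal{E}$: given an $\mathcal{E}$-election $(C,V)$, a preferred candidate $p\in C$, a cost function $c$ assigning to each possible swap in each vote a non-negative integer, and a budget $\beta\in\mathbb{N}$, decide whether there is an admissible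 set $\Gamma$ of swaps of total cost at most $\beta$ such that $p$ is a winner in the $\mathcal{E}$-election $(C,V^{\Gamma})$. *)

theory Defs
  imports
    Complex_Main
    "HOL-Library.Log_Nat"
    "HOL-Combinatorics.Transposition"
    "HOL-Combinatorics.Multiset_Permutations"
    "HOL-Computational_Algebra.Polynomial"
begin

section \<open>Elections\<close>

text \<open>
  A strict linear order over a finite candidate set \<open>C\<close> is given as a list, best candidate first,
  that contains every element of \<open>C\<close> exactly once; the set of these lists is
  \<^const>\<open>permutations_of_set\<close>\<open> C\<close>. The votes form a list, so that several voters may have the same
  order. An election system maps an election to its set of winners.
\<close>

type_synonym 'c vote = "'c list"
type_synonym 'c election_system = "'c set \<Rightarrow> 'c vote list \<Rightarrow> 'c set"

definition election :: "'c set \<Rightarrow> 'c vote list \<Rightarrow> bool" where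
  "election C V \<longleftrightarrow> finite C \<and> set V \<subseteq> permutations_of_set C"

definition rank :: "'c \<Rightarrow> 'c vote \<Rightarrow> nat" where
  "rank c v = length (takeWhile (\<lambda>x. x \<noteq> c) v) + 1"

definition approval_score :: "nat \<Rightarrow> 'c vote list \<Rightarrow> 'c \<Rightarrow> nat" where
  "approval_score k V c = card {i. i < length V \<and> rank c (V ! i) \<le> k}"

definition k_approval :: "nat \<Rightarrow> 'c election_system" where
  "k_approval k C V = {c \<in> C. \<forall>d \<in> C. approval_score k V d \<le> approval_score k V c}"


section \<open>Swaps\<close>

text \<open>Within a single vote, a swap is a pair of candidates.\<close>

definition admissible_swap :: "'c vote \<Rightarrow> 'c \<times> 'c \<Rightarrow> bool" where
  "admissible_swap v = (\<lambda>(a, b). a \<in> set v \<and> b \<in> set v \<and> a \<noteq> b \<and> rank b v = rank a v + 1)"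

definition apply_swap :: "'c \<times> 'c \<Rightarrow> 'c vote \<Rightarrow> 'c vote" where
  "apply_swap = (\<lambda>(a, b). map (transpose a b))"

inductive swap_sequence :: "'c vote \<Rightarrow> ('c \<times> 'c) list \<Rightarrow> 'c vote \<Rightarrow> bool" where
  Nil: "swap_sequence v [] v"
| Cons: "admissible_swap v s \<Longrightarrow> swap_sequence (apply_swap s v) ss w \<Longrightarrow> swap_sequence v (s # ss) w"

text \<open>
  A set of swaps is applied by performing each of its elements exactly once, in some order. The
  resulting vote does not depend on the order (lemma \<open>swapped_vote_unique\<close> below).
\<close>

definition admissible_in :: "('c \<times> 'c) set \<Rightarrow> 'c vote \<Rightarrow> bool" where
  "admissible_in \<Gamma> v \<longleftrightarrow> (\<exists>ss w. distinct ss \<and> set ss = \<Gamma> \<and> swap_sequence v ss w)"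

definition swapped_vote :: "('c \<times> 'c) set \<Rightarrow> 'c vote \<Rightarrow> 'c vote" where
  "swapped_vote \<Gamma> v = (THE w. \<exists>ss. distinct ss \<and> set ss = \<Gamma> \<and> swap_sequence v ss w)"

text \<open>
  For a list \<open>V\<close> of votes, a swap is a triple \<open>(i, a, b)\<close> whose first component is the position in
  \<open>V\<close> of the vote concerned: equal votes of different voters have to be kept apart.
\<close>

definition swaps_at :: "(nat \<times> 'c \<times> 'c) set \<Rightarrow> nat \<Rightarrow> ('c \<times> 'c) set" where
  "swaps_at \<Gamma> i = {(a, b). (i, a, b) \<in> \<Gamma>}"

definition admissible :: "'c vote list \<Rightarrow> (nat \<times> 'c \<times> 'c) set \<Rightarrow> bool" where
  "admissible V \<Gamma> \<longleftrightarrow>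
     (\<forall>(i, a, b) \<in> \<Gamma>. i < length V) \<and> (\<forall>i < length V. admissible_in (swaps_at \<Gamma> i) (V ! i))"

definition swapped_votes :: "(nat \<times> 'c \<times> 'c) set \<Rightarrow> 'c vote list \<Rightarrow> 'c vote list" where
  "swapped_votes \<Gamma> V = map (\<lambda>i. swapped_vote (swaps_at \<Gamma> i) (V ! i)) [0..<length V]"


subsection \<open>Independence of the order of application\<close>

lemma rank_map_transpose: "rank x (map (transpose a b) v) = rank (transpose a b x) v"
proof -
  have "(\<lambda>y. y \<noteq> x) \<circ> transpose a b = (\<lambda>y. y \<noteq> transpose a b x)"
    by (auto simp: fun_eq_iff transpose_eq_iff)
  then show ?thesis by (simp add: rank_def takeWhile_map)
qed

lemma nth_rank: "x \<in> set v \<Longrightarrow> rank x v - 1 < length v \<and> v ! (rank x v - 1) = x"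
  by (induction v) (auto simp: rank_def)

lemma rank_inject: "x \<in> set v \<Longrightarrow> y \<in> set v \<Longrightarrow> rank x v = rank y v \<Longrightarrow> x = y"
  by (metis nth_rank)

lemma rank_nth: "distinct v \<Longrightarrow> i < length v \<Longrightarrow> rank (v ! i) v = i + 1"
  by (metis nth_rank nth_mem nth_eq_iff_index_eq rank_def add_diff_cancel_right')

lemma vote_eqI:
  assumes "distinct v" "distinct w" "set v = set w"
    and "\<And>x y. x \<in> set v \<Longrightarrow> y \<in> set v \<Longrightarrow> rank x v < rank y v \<longleftrightarrow> rank x w < rank y w"
  shows "v = w"
proof -
  have *: "rank x u = card {y \<in> set u. rank y u < rank x u} + 1"
    if u: "distinct u" and x: "x \<in> set u" for x u
  proof -
    have "{y \<in> set u. rank y u < rank x u} = (\<lambda>i. u ! i) ` {..<rank x u - 1}"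
    proof (intro equalityI subsetI)
      fix y assume "y \<in> {y \<in> set u. rank y u < rank x u}"
      then show "y \<in> (\<lambda>i. u ! i) ` {..<rank x u - 1}"
        using nth_rank[of y u] by (intro image_eqI[of _ _ "rank y u - 1"]) (auto simp: rank_def)
    next
      fix y assume "y \<in> (\<lambda>i. u ! i) ` {..<rank x u - 1}"
      then show "y \<in> {y \<in> set u. rank y u < rank x u}"
        using nth_rank[OF x] by (auto simp: rank_nth[OF u])
    qed
    moreover have "inj_on (\<lambda>i. u ! i) {..<rank x u - 1}"
      using nth_rank[OF x] u by (auto simp: inj_on_def nth_eq_iff_index_eq)
    ultimately show ?thesis by (simp add: card_image) (simp add: rank_def)
  qed
  have len: "length v = length w"
    using assms(1-3) by (metis distinct_card)
  have "v ! i = w ! i" if i: "i < length v" for i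
  proof -
    have "v ! i \<in> set v" using i by simp
    moreover have "{y \<in> set v. rank y v < rank (v ! i) v} = {y \<in> set w. rank y w < rank (v ! i) w}"
      using assms(3,4) calculation by blast
    ultimately have "rank (v ! i) w = i + 1"
      using *[OF assms(1), of "v ! i"] *[OF assms(2), of "v ! i"] assms(3) rank_nth[OF assms(1) i]
      by simp
    then show ?thesis
      using nth_rank[of "v ! i" w] \<open>v ! i \<in> set v\<close> assms(3) by simp
  qed
  then show ?thesis using len by (simp add: nth_equalityI)
qed

lemma apply_swap_keeps_candidates:
  assumes "admissible_swap v s"
  shows "set (apply_swap s v) = set v" "distinct v \<Longrightarrow> distinct (apply_swap s v)"
  using assms
  by (auto simp: apply_swap_def admissible_swap_def distinct_map transpose_def inj_on_def image_iff)

lemma rank_less_apply_swap: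
  assumes "admissible_swap v s" "x \<in> set v" "y \<in> set v"
  shows "of_bool (rank x (apply_swap s v) < rank y (apply_swap s v)) =
         (of_bool (rank x v < rank y v) - of_bool ((x, y) = s) + of_bool ((y, x) = s) :: int)"
proof -
  obtain a b where s: "s = (a, b)" by fastforce
  have ab: "a \<in> set v" "b \<in> set v" "a \<noteq> b" "rank b v = rank a v + 1"
    using assms(1) by (auto simp: admissible_swap_def s)
  have *: "rank z v < rank a v \<or> rank z v > rank a v + 1" if "z \<in> set v" "z \<noteq> a" "z \<noteq> b" for z
    using rank_inject[of z v a] rank_inject[of z v b] that ab by linarith
  have r: "rank z (apply_swap (a, b) v) = (if z = a then rank a v + 1 else if z = b then rank a v else rank z v)"
    for z using ab by (simp add: apply_swap_def rank_map_transpose transpose_def)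
  show ?thesis
    using *[OF assms(2)] *[OF assms(3)] ab(3,4)
    by (cases "x = a"; cases "x = b"; cases "y = a"; cases "y = b") (auto simp: r s)
qed

lemma swap_sequence_rank_less:
  assumes "swap_sequence v ss w" "distinct ss" "distinct v"
  shows "set w = set v \<and> distinct w \<and>
    (\<forall>x \<in> set v. \<forall>y \<in> set v. of_bool (rank x w < rank y w) =
       (of_bool (rank x v < rank y v) - of_bool ((x, y) \<in> set ss) + of_bool ((y, x) \<in> set ss) :: int))"
  using assms
proof (induction rule: swap_sequence.induct)
  case (Nil v)
  then show ?case by simp
next
  case (Cons v s ss w)
  note keep = apply_swap_keeps_candidates[OF Cons.hyps(1)]
  have IH: "set w = set (apply_swap s v) \<and> distinct w \<and>
    (\<forall>x \<in> set v. \<forall>y \<in> set v. of_bool (rank x w < rank y w) =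
       (of_bool (rank x (apply_swap s v) < rank y (apply_swap s v))
         - of_bool ((x, y) \<in> set ss) + of_bool ((y, x) \<in> set ss) :: int))"
    using Cons.IH Cons.prems keep by simp
  show ?case
    using IH keep(1) Cons.prems(1) rank_less_apply_swap[OF Cons.hyps(1)] by auto
qed

lemma swapped_vote_unique:
  assumes "distinct v"
    and "distinct ss" "set ss = \<Gamma>" "swap_sequence v ss w"
    and "distinct ss'" "set ss' = \<Gamma>" "swap_sequence v ss' w'"
  shows "w = w'"
proof -
  note 1 = swap_sequence_rank_less[OF assms(4,2,1)] and 2 = swap_sequence_rank_less[OF assms(7,5,1)]
  show ?thesis
  proof (rule vote_eqI)
    fix x y assume "x \<in> set w" "y \<in> set w"
    then have "of_bool (rank x w < rank y w) = (of_bool (rank x w' < rank y w') :: int)"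
      using 1 2 assms(3,6) by simp
    then show "rank x w < rank y w \<longleftrightarrow> rank x w' < rank y w'"
      by (simp only: of_bool_eq_iff)
  qed (use 1 2 in auto)
qed

lemma swapped_vote_eq:
  assumes "distinct v" "distinct ss" "set ss = \<Gamma>" "swap_sequence v ss w"
  shows "swapped_vote \<Gamma> v = w"
  unfolding swapped_vote_def using assms swapped_vote_unique[OF assms(1)] by (intro the_equality) blast+


section \<open>Swap Bribery\<close>

definition swap_bribery ::
  "'c election_system \<Rightarrow> 'c set \<Rightarrow> 'c vote list \<Rightarrow> 'c \<Rightarrow> (nat \<times> 'c \<times> 'c \<Rightarrow> nat) \<Rightarrow> nat \<Rightarrow> bool" where
  "swap_bribery \<E> C V p c \<beta> \<longleftrightarrow>
     (\<exists>\<Gamma>. admissible V \<Gamma> \<and> (\<Sum>s\<in>\<Gamma>. c s) \<le> \<beta> \<and> p \<in> \<E> C (swapped_votes \<Gamma> V))"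

text \<open>
  Instances in which every swap has cost 1. The candidates are named \<open>0, \<dots>, m - 1\<close>. There is no
  restriction on \<open>k\<close>, and \<open>V\<close> may be empty.
\<close>

record unit_instance =
  num_cands :: nat
  votes :: "nat vote list"
  approvals :: nat
  preferred :: nat
  budget :: nat

definition candidates :: "unit_instance \<Rightarrow> nat set" where
  "candidates I = {..<num_cands I}"

definition valid_instance :: "unit_instance \<Rightarrow> bool" where
  "valid_instance I \<longleftrightarrow> election (candidates I) (votes I) \<and> preferred I \<in> candidates I"

definition k_approval_unit_swap_bribery :: "unit_instance \<Rightarrow> bool" where
  "k_approval_unit_swap_bribery I \<longleftrightarrow>
     swap_bribery (k_approval (approvals I)) (candidates I) (votes I) (preferred I) (\<lambda>_. 1) (budget I)"

definition encode_instance :: "unit_instance \<Rightarrow> nat list" where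
  "encode_instance I =
     [num_cands I, length (votes I), approvals I, preferred I, budget I] @ concat (votes I)"


section \<open>Polynomial time\<close>

text \<open>
  The machine model is a random access machine, presented as a while language over finitely many
  arrays of natural numbers: \<open>Read x e\<close> is the cell of array \<open>x\<close> at the index given by \<open>e\<close>, and
  \<open>Write x e d\<close> stores the value of \<open>d\<close> in that cell. Every operation takes one time unit. There is
  no multiplication, only addition and truncated subtraction, so that \<open>t\<close> steps of a fixed program
  lengthen the binary representation of the numbers involved (values and addresses) by only \<open>O(t)\<close>
  bits. Hence unit cost, logarithmic cost and Turing machine time are polynomially related
  if the size of the input is its total length in binary, as it is below.
\<close>

datatype expr =
    Const nat
  | Read nat expr
  | Add expr expr
  | Sub expr expr

datatype prog =
    Skip
  | Write nat expr expr
  | Seq prog prog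
  | If expr prog prog
  | While expr prog

type_synonym store = "nat \<Rightarrow> nat \<Rightarrow> nat"

primrec expr_value :: "expr \<Rightarrow> store \<Rightarrow> nat" where
  "expr_value (Const n) \<sigma> = n"
| "expr_value (Read x e) \<sigma> = \<sigma> x (expr_value e \<sigma>)"
| "expr_value (Add e d) \<sigma> = expr_value e \<sigma> + expr_value d \<sigma>"
| "expr_value (Sub e d) \<sigma> = expr_value e \<sigma> - expr_value d \<sigma>"

primrec expr_time :: "expr \<Rightarrow> nat" where
  "expr_time (Const n) = 1"
| "expr_time (Read x e) = expr_time e + 1"
| "expr_time (Add e d) = expr_time e + expr_time d + 1"
| "expr_time (Sub e d) = expr_time e + expr_time d + 1"

text \<open>\<open>run P \<sigma> t \<tau>\<close>: started in \<open>\<sigma>\<close>, the program \<open>P\<close> halts after \<open>t\<close> steps in \<open>\<tau>\<close>.\<close>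

inductive run :: "prog \<Rightarrow> store \<Rightarrow> nat \<Rightarrow> store \<Rightarrow> bool" where
  Skip: "run Skip \<sigma> 1 \<sigma>"
| Write: "run (Write x e d) \<sigma> (expr_time e + expr_time d + 1)
            (\<sigma>(x := (\<sigma> x)(expr_value e \<sigma> := expr_value d \<sigma>)))"
| Seq: "run P \<sigma> t \<tau> \<Longrightarrow> run Q \<tau> u \<upsilon> \<Longrightarrow> run (Seq P Q) \<sigma> (t + u) \<upsilon>"
| If_True: "expr_value e \<sigma> \<noteq> 0 \<Longrightarrow> run P \<sigma> t \<tau> \<Longrightarrow> run (If e P Q) \<sigma> (expr_time e + t + 1) \<tau>"
| If_False: "expr_value e \<sigma> = 0 \<Longrightarrow> run Q \<sigma> t \<tau> \<Longrightarrow> run (If e P Q) \<sigma> (expr_time e + t + 1) \<tau>"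
| While_True: "expr_value e \<sigma> \<noteq> 0 \<Longrightarrow> run P \<sigma> t \<tau> \<Longrightarrow> run (While e P) \<tau> u \<upsilon> \<Longrightarrow>
    run (While e P) \<sigma> (expr_time e + t + u + 1) \<upsilon>"
| While_False: "expr_value e \<sigma> = 0 \<Longrightarrow> run (While e P) \<sigma> (expr_time e + 1) \<sigma>"

lemma run_deterministic: "run P \<sigma> t \<tau> \<Longrightarrow> run P \<sigma> t' \<tau>' \<Longrightarrow> t' = t \<and> \<tau>' = \<tau>"
proof (induction arbitrary: t' \<tau>' rule: run.induct)
  case Skip
  from Skip.prems show ?case by cases simp
next
  case Write
  from Write.prems show ?case by cases simp
next
  case (Seq P \<sigma> t \<tau> Q u \<upsilon>)
  from Seq.prems obtain t1 u1 \<tau>1 where "t' = t1 + u1" "run P \<sigma> t1 \<tau>1" "run Q \<tau>1 u1 \<tau>'"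
    by cases auto
  then show ?case using Seq.IH by metis
next
  case (If_True e \<sigma> P t \<tau> Q)
  from If_True.prems If_True.hyps(1) obtain t1 where "t' = expr_time e + t1 + 1" "run P \<sigma> t1 \<tau>'"
    by cases auto
  then show ?case using If_True.IH by metis
next
  case (If_False e \<sigma> Q t \<tau> P)
  from If_False.prems If_False.hyps(1) obtain t1 where "t' = expr_time e + t1 + 1" "run Q \<sigma> t1 \<tau>'"
    by cases auto
  then show ?case using If_False.IH by metis
next
  case (While_True e \<sigma> P t \<tau> u \<upsilon>)
  from While_True.prems While_True.hyps(1) obtain t1 u1 \<tau>1 where
    "t' = expr_time e + t1 + u1 + 1" "run P \<sigma> t1 \<tau>1" "run (While e P) \<tau>1 u1 \<tau>'"
    by cases auto
  then show ?case using While_True.IH by metis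
next
  case While_False
  from While_False.prems show ?case by cases (simp_all add: While_False.hyps)
qed

text \<open>
  The input is placed in array \<open>0\<close> and its length in cell \<open>0\<close> of array \<open>1\<close>; all other cells are
  \<open>0\<close>. The answer is yes if cell \<open>0\<close> of array \<open>0\<close> is nonzero in the end.
\<close>

definition initial_store :: "nat list \<Rightarrow> store" where
  "initial_store xs = (\<lambda>x i.
     if x = 0 \<and> i < length xs then xs ! i else if x = 1 \<and> i = 0 then length xs else 0)"

definition accepting :: "store \<Rightarrow> bool" where
  "accepting \<sigma> \<longleftrightarrow> \<sigma> 0 0 \<noteq> 0"

definition input_size :: "nat list \<Rightarrow> nat" where
  "input_size xs = (\<Sum>n\<leftarrow>xs. max 1 (floorlog 2 n))"

definition decidable_in_poly_time :: "'i set \<Rightarrow> ('i \<Rightarrow> nat list) \<Rightarrow> ('i \<Rightarrow> bool) \<Rightarrow> bool" where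
  "decidable_in_poly_time instances encode problem \<longleftrightarrow>
     (\<exists>P. \<exists>q :: nat poly. \<forall>I \<in> instances. \<exists>t \<tau>.
        run P (initial_store (encode I)) t \<tau> \<and>
        t \<le> poly q (input_size (encode I)) \<and>
        (accepting \<tau> \<longleftrightarrow> problem I))"

end

theory Submission
  imports Defs
begin

text \<open>
  Only the set of the first \<open>k\<close> candidates of each vote matters. The least number of swaps that brings
  a given \<open>k\<close>-set \<open>S\<close> to the top of a vote is a sum of separate contributions of the candidates: each
  adjacent swap decreases this sum by at most 1, and while \<open>S\<close> is not on top, some element of \<open>S\<close>
  directly follows a non-element, so that swapping these two decreases it by exactly 1.
  Hence, for a fixed final score \<open>s\<close> of \<open>p\<close>, the problem is a minimum-cost transportation problem between
  votes and candidates, which is turned into an assignment problem of polynomial size with polynomially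
  bounded costs. This is solved by an auction with bid increment 1, after scaling the costs so
  that approximate complementary slackness implies optimality. Every bid raises a price and all prices are
  polynomially bounded, so polynomially many bids suffice.
\<close>

section \<open>The number of swaps needed for given approval sets\<close>

text \<open>Winning compares two unknown scores. Guessing the final score \<open>s\<close> of
  \<open>p\<close> turns the comparison into separate constraints on the candidates: exactly
  \<open>s\<close> approvals for \<open>p\<close> and at most \<open>s\<close> for everyone else.

  The auction is only pseudo-polynomial: the number of bids grows with the largest cost itself, not
  with its binary length. Unit swap costs make this harmless, since no family of approval sets costs
  more than \<open>n * m * m\<close>. The budget, however, is written in binary and may be huge, so
  it is cut down to that value before it is used.

  A positive bid increment is what guarantees progress. Without it, two persons could displace each
  other from equally good objects forever at unchanged prices. Its price is an error of at most 1
  per person, and the scaling factor \<open>N + 1\<close> is chosen to exceed the total error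
  \<open>N\<close>.

  The machine proof needs iteration bounds that are known beforehand. The auction therefore runs for
  a fixed number of rounds, idling once everybody has an object, and one number \<open>M\<close>
  bounds every loop of the program.\<close>

text \<open>
  The differences are truncated: a candidate of \<open>S\<close> pays for the positions that it is too far down,
  any other candidate for those that it is too far up. If \<open>card S = k\<close>, this is the least number of
  swaps in \<open>v\<close> that brings \<open>S\<close> to the top \<open>k\<close> positions.
\<close>

definition exchange_cost :: "nat \<Rightarrow> 'c set \<Rightarrow> 'c vote \<Rightarrow> nat" where
  "exchange_cost k S v = (\<Sum>c\<in>set v. if c \<in> S then rank c v - 1 - k else k - (rank c v - 1))"

section \<open>Exchange cost under swaps\<close>

lemma rank_pos: "rank c v \<ge> 1"
  by (simp add: rank_def)

lemma exchange_cost_nth: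
  assumes "distinct v"
  shows "exchange_cost k S v = (\<Sum>r<length v. if v ! r \<in> S then r - k else k - r)"
proof -
  have "bij_betw ((!) v) {..<length v} (set v)"
    using assms by (simp add: bij_betw_nth lessThan_atLeast0)
  then have "exchange_cost k S v =
      (\<Sum>r<length v. if v ! r \<in> S then rank (v ! r) v - 1 - k else k - (rank (v ! r) v - 1))"
    unfolding exchange_cost_def by (rule sum.reindex_bij_betw[symmetric])
  also have "\<dots> = (\<Sum>r<length v. if v ! r \<in> S then r - k else k - r)"
    using rank_nth[OF assms] by (intro sum.cong) auto
  finally show ?thesis .
qed

text \<open>Crossing between the 0-based positions \<open>r\<close> and \<open>r + 1\<close> is
  charged to non-members of \<open>S\<close> if \<open>r < k\<close> and to members otherwise, never
  to both. So a member overtaking a non-member saves exactly 1, the reverse swap adds 1, and for two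
  members or two non-members the changes cancel.\<close>

lemma exchange_cost_apply_swap:
  assumes "admissible_swap v (a, b)"
  shows "exchange_cost k S v \<le> exchange_cost k S (apply_swap (a, b) v) + 1"
    and "a \<notin> S \<Longrightarrow> b \<in> S \<Longrightarrow> exchange_cost k S v = exchange_cost k S (apply_swap (a, b) v) + 1"
proof -
  have ab: "a \<in> set v" "b \<in> set v" "a \<noteq> b" "rank b v = rank a v + 1"
    using assms by (auto simp: admissible_swap_def)
  define f where "f u c = (if c \<in> S then rank c u - 1 - k else k - (rank c u - 1))" for u :: "'a vote" and c
  let ?w = "apply_swap (a, b) v"
  have set: "set ?w = set v"
    using apply_swap_keeps_candidates(1)[OF assms] .
  have r: "rank z ?w = (if z = a then rank a v + 1 else if z = b then rank a v else rank z v)" for z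
    using ab by (simp add: apply_swap_def rank_map_transpose transpose_def)
  have split: "sum (f u) (set v) = f u a + f u b + sum (f u) (set v - {a, b})" for u
    using ab by (subst sum.subset_diff[of "{a, b}"]) auto
  have rest: "sum (f ?w) (set v - {a, b}) = sum (f v) (set v - {a, b})"
    by (intro sum.cong) (auto simp: f_def r)
  have cost: "exchange_cost k S v = f v a + f v b + sum (f v) (set v - {a, b})"
    "exchange_cost k S ?w = f ?w a + f ?w b + sum (f v) (set v - {a, b})"
    using split[of v] split[of ?w] rest by (simp_all add: exchange_cost_def set f_def)
  have f: "f v a = (if a \<in> S then rank a v - 1 - k else k - (rank a v - 1))"
    "f v b = (if b \<in> S then rank a v - k else k - rank a v)"
    "f ?w a = (if a \<in> S then rank a v - k else k - rank a v)"
    "f ?w b = (if b \<in> S then rank a v - 1 - k else k - (rank a v - 1))"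
    using ab by (auto simp: f_def r)
  show "exchange_cost k S v \<le> exchange_cost k S ?w + 1"
    using rank_pos[of a v] unfolding cost f by (auto split: if_splits)
  show "a \<notin> S \<Longrightarrow> b \<in> S \<Longrightarrow> exchange_cost k S v = exchange_cost k S ?w + 1"
    using rank_pos[of a v] unfolding cost f by (auto split: if_splits)
qed

lemma exchange_cost_swap_sequence:
  "swap_sequence v ss w \<Longrightarrow> exchange_cost k S v \<le> exchange_cost k S w + length ss"
proof (induction rule: swap_sequence.induct)
  case (Cons v s ss w)
  obtain a b where s: "s = (a, b)" by fastforce
  show ?case
    using Cons exchange_cost_apply_swap(1)[of v a b k S] by (simp add: s)
qed simp

lemma exchange_cost_top: "exchange_cost k {c \<in> set v. rank c v \<le> k} v = 0"
  by (auto simp: exchange_cost_def)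

lemma card_top:
  assumes "distinct v" "k \<le> length v"
  shows "card {c \<in> set v. rank c v \<le> k} = k"
proof -
  have "{c \<in> set v. rank c v \<le> k} = (!) v ` {..<k}"
  proof (intro equalityI subsetI)
    fix c assume c: "c \<in> {c \<in> set v. rank c v \<le> k}"
    then show "c \<in> (!) v ` {..<k}"
      using nth_rank[of c v] rank_pos[of c v] by (intro image_eqI[of _ _ "rank c v - 1"]) auto
  next
    fix c assume "c \<in> (!) v ` {..<k}"
    then show "c \<in> {c \<in> set v. rank c v \<le> k}"
      using rank_nth[OF assms(1)] assms(2) by auto
  qed
  moreover have "inj_on ((!) v) {..<k}"
    using assms by (auto simp: inj_on_def nth_eq_iff_index_eq)
  ultimately show ?thesis by (simp add: card_image)
qed

text \<open>The positions held by \<open>S\<close> are closed downwards, hence form an initial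
  segment. Contrapositively, if \<open>S\<close> is not on top, there is an adjacent pair to
  swap.\<close>

lemma top_if_sorted:
  assumes v: "distinct v" and S: "S \<subseteq> set v"
    and sorted: "\<And>q. q + 1 < length v \<Longrightarrow> v ! (q + 1) \<in> S \<Longrightarrow> v ! q \<in> S"
  shows "{c \<in> set v. rank c v \<le> card S} = S"
proof -
  define Q where "Q = {q. q < length v \<and> v ! q \<in> S}"
  have down: "q \<in> Q" if "q' \<in> Q" "q \<le> q'" for q q'
    using that(2,1)
  proof (induction rule: inc_induct)
    case (step i)
    then show ?case using sorted[of i] by (auto simp: Q_def)
  qed
  have fin: "finite Q" by (simp add: Q_def)
  have Q: "Q = {..<card Q}"
  proof (rule card_subset_eq[symmetric])
    show "finite Q" by fact
    show "card {..<card Q} = card Q" by simp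
    show "{..<card Q} \<subseteq> Q"
    proof (rule ccontr)
      assume "\<not> {..<card Q} \<subseteq> Q"
      then obtain q where q: "q < card Q" "q \<notin> Q" by auto
      have "Q \<subseteq> {..<q}"
        using down q(2) by (metis lessThan_iff not_le subsetI)
      then have "card Q \<le> q"
        using card_mono[of "{..<q}" Q] by simp
      with q show False by simp
    qed
  qed
  have "S = (!) v ` Q"
    using S by (fastforce simp: Q_def in_set_conv_nth image_iff subset_iff)
  moreover have "inj_on ((!) v) Q"
    using v by (auto simp: inj_on_def Q_def nth_eq_iff_index_eq)
  ultimately have card: "card S = card Q" by (simp add: card_image)
  then have mem: "q \<in> Q \<longleftrightarrow> q < card S" for q
    by (subst Q) simp
  show ?thesis
  proof (intro equalityI subsetI)
    fix c assume "c \<in> {c \<in> set v. rank c v \<le> card S}"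
    then have "c = v ! (rank c v - 1)" "rank c v - 1 \<in> Q"
      using nth_rank[of c v] rank_pos[of c v] by (auto simp: mem)
    then show "c \<in> S" by (simp add: Q_def)
  next
    fix c assume c: "c \<in> S"
    then have "rank c v - 1 \<in> Q"
      using nth_rank[of c v] S by (auto simp: Q_def)
    then have "rank c v - 1 < card S" by (simp add: mem)
    then show "c \<in> {c \<in> set v. rank c v \<le> card S}"
      using c S by auto
  qed
qed

text \<open>
  Every swap moves an element of \<open>S\<close> past a non-element, hence none is ever repeated or undone and
  the swaps form a set.
\<close>

lemma swap_sequence_to_top:
  assumes "distinct v" "S \<subseteq> set v"
  shows "\<exists>ss w. swap_sequence v ss w \<and> distinct ss \<and> length ss = exchange_cost (card S) S v \<and>
    {c \<in> set v. rank c w \<le> card S} = S \<and>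
    set ss \<subseteq> {(a, b). a \<in> set v - S \<and> b \<in> S \<and> rank a v < rank b v}"
  using assms
proof (induction "exchange_cost (card S) S v" arbitrary: v rule: less_induct)
  case (less v)
  show ?case
  proof (cases "\<exists>q. q + 1 < length v \<and> v ! (q + 1) \<in> S \<and> v ! q \<notin> S")
    case False
    then have top: "{c \<in> set v. rank c v \<le> card S} = S"
      by (intro top_if_sorted less.prems) auto
    then have "exchange_cost (card S) S v = 0"
      using exchange_cost_top[of "card S" v] by simp
    then show ?thesis
      using top swap_sequence.Nil by (intro exI[of _ "[]"] exI[of _ v]) auto
  next
    case True
    then obtain q where q: "q + 1 < length v" "v ! (q + 1) \<in> S" "v ! q \<notin> S" by blast
    define a b where ab: "a = v ! q" "b = v ! (q + 1)"
    define u where "u = apply_swap (a, b) v"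
    have adm: "admissible_swap v (a, b)"
      using q rank_nth[OF less.prems(1)] less.prems(1)
      by (auto simp: admissible_swap_def ab nth_eq_iff_index_eq)
    have u: "set u = set v" "distinct u"
      using apply_swap_keeps_candidates[OF adm] less.prems(1) by (auto simp: u_def)
    have cost: "exchange_cost (card S) S v = exchange_cost (card S) S u + 1"
      unfolding u_def using q by (intro exchange_cost_apply_swap(2)[OF adm]) (auto simp: ab)
    obtain ss w where w: "swap_sequence u ss w" "distinct ss"
      "length ss = exchange_cost (card S) S u" "{c \<in> set u. rank c w \<le> card S} = S"
      and ss: "set ss \<subseteq> {(a, b). a \<in> set u - S \<and> b \<in> S \<and> rank a u < rank b u}"
      using less.hyps[of u] cost u less.prems by auto
    have in_v: "a \<in> set v" "b \<in> set v" using q by (auto simp: ab)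
    \<comment> \<open>The first swap reverses only the pair \<open>a\<close>, \<open>b\<close>. A
      later pair \<open>(x, y)\<close> cannot be \<open>(b, a)\<close>, because \<open>b\<close>
      lies in \<open>S\<close> and \<open>x\<close> does not; so its order in \<open>u\<close> is
      already its order in \<open>v\<close>.\<close>
    have less_v: "rank x v < rank y v" if "(x, y) \<in> set ss" for x y
    proof -
      have xy: "x \<in> set v" "x \<notin> S" "y \<in> S" "rank x u < rank y u"
        using ss that u by auto
      then have "y \<in> set v" using less.prems by auto
      then show ?thesis
        using rank_less_apply_swap[OF adm, of x y] xy q by (auto simp: u_def ab of_bool_def split: if_splits)
    qed
    have "(a, b) \<notin> set ss"
    proof
      assume "(a, b) \<in> set ss"
      then have "rank a u < rank b u" using ss by auto
      then show False
        using rank_less_apply_swap[OF adm in_v] adm by (auto simp: u_def admissible_swap_def)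
    qed
    moreover have "rank a v < rank b v" using adm by (simp add: admissible_swap_def)
    moreover have "swap_sequence v ((a, b) # ss) w"
      using adm w(1) by (auto simp: u_def intro: swap_sequence.Cons)
    ultimately show ?thesis
      using w cost ss u less_v q in_v
      by (intro exI[of _ "(a, b) # ss"] exI[of _ w]) (auto simp: ab)
  qed
qed

section \<open>From sets of swaps to families of approval sets\<close>

lemma swapped_vote_obtain:
  assumes "distinct v" "admissible_in \<Gamma> v"
  obtains ss where "distinct ss" "set ss = \<Gamma>" "swap_sequence v ss (swapped_vote \<Gamma> v)"
    "set (swapped_vote \<Gamma> v) = set v" "distinct (swapped_vote \<Gamma> v)"
proof -
  obtain ss w where ss: "distinct ss" "set ss = \<Gamma>" "swap_sequence v ss w"
    using assms(2) by (auto simp: admissible_in_def)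
  moreover have "swapped_vote \<Gamma> v = w"
    by (rule swapped_vote_eq[OF assms(1) ss])
  ultimately show ?thesis
    using that swap_sequence_rank_less[OF ss(3,1) assms(1)] by simp
qed

text \<open>The set is the one that is on top after the swaps, where its cost is 0; each swap can
  have removed at most 1 from the initial cost.\<close>

lemma exchange_cost_le_card:
  assumes "distinct v" "admissible_in \<Gamma> v"
  shows "exchange_cost k {c \<in> set v. rank c (swapped_vote \<Gamma> v) \<le> k} v \<le> card \<Gamma>"
proof -
  obtain ss where ss: "distinct ss" "set ss = \<Gamma>" "swap_sequence v ss (swapped_vote \<Gamma> v)"
    "set (swapped_vote \<Gamma> v) = set v"
    using swapped_vote_obtain[OF assms] by metis
  then show ?thesis
    using exchange_cost_swap_sequence[OF ss(3), of k "{c \<in> set v. rank c (swapped_vote \<Gamma> v) \<le> k}"]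
      exchange_cost_top[of k "swapped_vote \<Gamma> v"] distinct_card[of ss] by simp
qed

lemma card_admissible:
  assumes "admissible V \<Gamma>"
  shows "card \<Gamma> = (\<Sum>i<length V. card (swaps_at \<Gamma> i))"
proof -
  have fin: "finite (swaps_at \<Gamma> i)" if "i < length V" for i
    using assms that by (metis admissible_def admissible_in_def List.finite_set)
  have "\<Gamma> = (SIGMA i:{..<length V}. swaps_at \<Gamma> i)"
    using assms by (auto simp: admissible_def swaps_at_def)
  then have "card \<Gamma> = card (SIGMA i:{..<length V}. swaps_at \<Gamma> i)"
    by simp
  also have "\<dots> = (\<Sum>i<length V. card (swaps_at \<Gamma> i))"
    using fin by (intro card_SigmaI) auto
  finally show ?thesis .
qed

lemma approval_score_swapped:
  "approval_score k (swapped_votes \<Gamma> V) c =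
    card {i. i < length V \<and> rank c (swapped_vote (swaps_at \<Gamma> i) (V ! i)) \<le> k}"
  unfolding approval_score_def swapped_votes_def by (rule arg_cong[of _ _ card]) auto

text \<open>Swaps in different votes do not interact, so cheapest sequences can be chosen vote by
  vote and united. The bound on \<open>k\<close> makes every approval set have exactly
  \<open>k\<close> elements.\<close>

lemma swap_bribery_iff_approval_sets:
  assumes el: "election C V" and p: "p \<in> C" and k: "k \<le> card C"
  shows "swap_bribery (k_approval k) C V p (\<lambda>_. 1) \<beta> \<longleftrightarrow>
    (\<exists>S. (\<forall>i<length V. S i \<subseteq> C \<and> card (S i) = k) \<and>
      (\<forall>d\<in>C. card {i. i < length V \<and> d \<in> S i} \<le> card {i. i < length V \<and> p \<in> S i}) \<and>
      (\<Sum>i<length V. exchange_cost k (S i) (V ! i)) \<le> \<beta>)" (is "?L \<longleftrightarrow> ?R")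
proof -
  have V: "set (V ! i) = C" "distinct (V ! i)" if "i < length V" for i
    using el that nth_mem[of i V] unfolding election_def permutations_of_set_def by blast+
  show ?thesis
  proof
    assume ?L
    then obtain \<Gamma> where \<Gamma>: "admissible V \<Gamma>" "card \<Gamma> \<le> \<beta>" "p \<in> k_approval k C (swapped_votes \<Gamma> V)"
      by (auto simp: swap_bribery_def)
    define S where "S i = {c \<in> C. rank c (swapped_vote (swaps_at \<Gamma> i) (V ! i)) \<le> k}" for i
    have adm: "admissible_in (swaps_at \<Gamma> i) (V ! i)" if "i < length V" for i
      using \<Gamma>(1) that by (simp add: admissible_def)
    have score: "approval_score k (swapped_votes \<Gamma> V) c = card {i. i < length V \<and> c \<in> S i}"
      if "c \<in> C" for c
      unfolding approval_score_swapped S_def using that by simp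
    have "card (S i) = k" if i: "i < length V" for i
    proof -
      have "set (swapped_vote (swaps_at \<Gamma> i) (V ! i)) = C \<and> distinct (swapped_vote (swaps_at \<Gamma> i) (V ! i))"
        using swapped_vote_obtain[OF V(2)[OF i] adm[OF i]] V(1)[OF i] by metis
      then show ?thesis
        using card_top[of "swapped_vote (swaps_at \<Gamma> i) (V ! i)" k] k by (auto simp: S_def distinct_card[symmetric])
    qed
    moreover have "(\<Sum>i<length V. exchange_cost k (S i) (V ! i)) \<le> \<beta>"
    proof -
      have "(\<Sum>i<length V. exchange_cost k (S i) (V ! i)) \<le> (\<Sum>i<length V. card (swaps_at \<Gamma> i))"
        using exchange_cost_le_card[OF V(2) adm] V(1) by (intro sum_mono) (auto simp: S_def)
      then show ?thesis using card_admissible[OF \<Gamma>(1)] \<Gamma>(2) by simp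
    qed
    ultimately show ?R
      using \<Gamma>(3) score p by (intro exI[of _ S]) (auto simp: k_approval_def S_def)
  next
    assume ?R
    then obtain S where S: "\<And>i. i < length V \<Longrightarrow> S i \<subseteq> C \<and> card (S i) = k"
      and win: "\<And>d. d \<in> C \<Longrightarrow> card {i. i < length V \<and> d \<in> S i} \<le> card {i. i < length V \<and> p \<in> S i}"
      and cost: "(\<Sum>i<length V. exchange_cost k (S i) (V ! i)) \<le> \<beta>"
      by blast
    define P where "P i ss w \<longleftrightarrow> swap_sequence (V ! i) ss w \<and> distinct ss \<and>
      length ss = exchange_cost k (S i) (V ! i) \<and> {c \<in> C. rank c w \<le> k} = S i" for i ss w
    have "\<exists>ss w. P i ss w" if "i < length V" for i
      unfolding P_def using swap_sequence_to_top[of "V ! i" "S i"] V[OF that] S[OF that] by blast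
    then obtain ss w where "\<And>i. i < length V \<Longrightarrow> P i (ss i) (w i)"
      by metis
    then have ss: "\<And>i. i < length V \<Longrightarrow> swap_sequence (V ! i) (ss i) (w i)"
      "\<And>i. i < length V \<Longrightarrow> distinct (ss i)"
      "\<And>i. i < length V \<Longrightarrow> length (ss i) = exchange_cost k (S i) (V ! i)"
      "\<And>i. i < length V \<Longrightarrow> {c \<in> C. rank c (w i) \<le> k} = S i"
      by (auto simp: P_def)
    define \<Gamma> where "\<Gamma> = (SIGMA i:{..<length V}. set (ss i))"
    have at: "swaps_at \<Gamma> i = set (ss i)" if "i < length V" for i
      using that by (auto simp: \<Gamma>_def swaps_at_def)
    have adm: "admissible V \<Gamma>"
      unfolding admissible_def using ss(1,2) at by (auto simp: admissible_in_def \<Gamma>_def)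
    have "card \<Gamma> \<le> \<beta>"
      using card_admissible[OF adm] cost at ss(2,3) by (simp add: distinct_card)
    moreover have w: "swapped_vote (swaps_at \<Gamma> i) (V ! i) = w i" if "i < length V" for i
      using swapped_vote_eq[OF V(2) ss(2) _ ss(1), OF that that _ that] at[OF that] by simp
    have "approval_score k (swapped_votes \<Gamma> V) c = card {i. i < length V \<and> c \<in> S i}" if "c \<in> C" for c
    proof -
      have "rank c (w i) \<le> k \<longleftrightarrow> c \<in> S i" if "i < length V" for i
        using ss(4)[OF that] \<open>c \<in> C\<close> by blast
      then show ?thesis
        unfolding approval_score_swapped using w by (intro arg_cong[of _ _ card] Collect_cong conj_cong refl) simp
    qed
    then have "p \<in> k_approval k C (swapped_votes \<Gamma> V)"
      using win p by (auto simp: k_approval_def)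
    ultimately show ?L
      using adm by (auto simp: swap_bribery_def)
  qed
qed

text \<open>All candidates tie already, with 0 points or with one point from each vote, so the empty
  set of swaps works. Disposing of these cases makes \<open>m - k\<close> positive and forces a
  positive winning score \<open>s\<close>; both occur as divisors in the assignment problem.\<close>

lemma swap_bribery_trivial:
  assumes el: "election C V" and p: "p \<in> C" and "k = 0 \<or> V = [] \<or> card C \<le> k"
  shows "swap_bribery (k_approval k) C V p (\<lambda>_. 1) \<beta>"
proof -
  have V: "set (V ! i) = C" "distinct (V ! i)" if "i < length V" for i
    using el that nth_mem[of i V] unfolding election_def permutations_of_set_def by blast+
  have adm: "admissible V {}"
    by (auto simp: admissible_def swaps_at_def admissible_in_def intro: swap_sequence.Nil)
  have "swapped_vote (swaps_at {} i) (V ! i) = V ! i" if "i < length V" for i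
    using swapped_vote_eq[OF V(2)[OF that], of "[]"] swap_sequence.Nil by (auto simp: swaps_at_def)
  then have same: "swapped_votes {} V = V"
    unfolding swapped_votes_def by (intro nth_equalityI) auto
  have full: "rank d (V ! i) \<le> card C" if "d \<in> C" "i < length V" for d i
    using nth_rank[of d "V ! i"] V[OF that(2)] that(1) distinct_card[of "V ! i"] by auto
  have "approval_score k V d \<le> approval_score k V p" if "d \<in> C" for d
    using assms(3)
  proof (elim disjE)
    assume "card C \<le> k"
    then have "rank c (V ! i) \<le> k" if "c \<in> C" "i < length V" for c i
      using full that by (meson le_trans)
    then have "approval_score k V c = length V" if "c \<in> C" for c
      using that unfolding approval_score_def by (subst Collect_cong[of _ "\<lambda>i. i < length V"]) auto
    then show ?thesis using that p by simp
  qed (auto simp: approval_score_def rank_def)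
  then show ?thesis
    unfolding swap_bribery_def using adm same p by (intro exI[of _ "{}"]) (auto simp: k_approval_def)
qed


section \<open>Reduction to an assignment problem\<close>

lemma card_div_eq:
  assumes "v < a" "0 < (b::nat)"
  shows "card {j. j < a * b \<and> j div b = v} = b"
proof -
  have "{j. j < a * b \<and> j div b = v} = {v * b..<v * b + b}"
  proof (intro equalityI subsetI)
    fix j assume "j \<in> {v * b..<v * b + b}"
    moreover from this have "j div b = v"
      using assms by (intro div_nat_eqI) (auto simp: mult.commute)
    moreover have "v * b + b \<le> a * b"
      using assms mult_le_mono1[of "Suc v" a b] by simp
    ultimately show "j \<in> {j. j < a * b \<and> j div b = v}" by auto
  next
    fix j assume "j \<in> {j. j < a * b \<and> j div b = v}"
    then show "j \<in> {v * b..<v * b + b}"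
      using assms dividend_less_div_times[of b j] by auto
  qed
  then show ?thesis by simp
qed

text \<open>Injections are chosen separately for each label. They glue together because
  \<open>l'\<close> recovers the label of an image, so images for different labels are
  disjoint.\<close>

lemma injection_between_fibres:
  assumes "finite B" and "\<And>a. card {x \<in> A. l x = a} \<le> card {y \<in> B. l' y = a}"
    and "finite A"
  obtains f where "inj_on f A" "f ` A \<subseteq> B" "\<And>x. x \<in> A \<Longrightarrow> l' (f x) = l x"
proof -
  have "\<exists>h. h ` {x \<in> A. l x = a} \<subseteq> {y \<in> B. l' y = a} \<and> inj_on h {x \<in> A. l x = a}" for a
    using assms by (intro card_le_inj) auto
  then have "\<forall>a. \<exists>h. h ` {x \<in> A. l x = a} \<subseteq> {y \<in> B. l' y = a} \<and> inj_on h {x \<in> A. l x = a}"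
    by blast
  from choice[OF this] obtain h where h: "\<And>a. h a ` {x \<in> A. l x = a} \<subseteq> {y \<in> B. l' y = a}"
    "\<And>a. inj_on (h a) {x \<in> A. l x = a}"
    by blast
  have mem: "h (l x) x \<in> B \<and> l' (h (l x) x) = l x" if "x \<in> A" for x
    using h(1)[of "l x"] that by auto
  show ?thesis
  proof
    show "inj_on (\<lambda>x. h (l x) x) A"
    proof (rule inj_onI)
      fix x y assume xy: "x \<in> A" "y \<in> A" and eq: "h (l x) x = h (l y) y"
      then have "l x = l y" using mem by metis
      then show "x = y"
        using h(2)[of "l x"] xy eq by (auto simp: inj_on_def)
    qed
  qed (use mem in auto)
qed

text \<open>The complements of domain and image have equal size. This is how the dummies are spread
  over the objects left by the real persons.\<close>

lemma injection_extends_to_permutation: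
  assumes "finite B" "A \<subseteq> B" "inj_on f A" "f ` A \<subseteq> B"
  obtains g where "bij_betw g B B" "\<And>x. x \<in> A \<Longrightarrow> g x = f x"
proof -
  have "card (B - A) = card (B - f ` A)"
    using assms by (simp add: card_Diff_subset finite_subset card_image)
  then obtain h where h: "bij_betw h (B - A) (B - f ` A)"
    using assms finite_same_card_bij by (metis finite_Diff)
  let ?g = "\<lambda>x. if x \<in> A then f x else h x"
  have "bij_betw ?g A (f ` A)"
    using assms(3) by (subst bij_betw_cong[of _ _ f]) (auto simp: inj_on_imp_bij_betw)
  moreover have "bij_betw ?g (B - A) (B - f ` A)"
    using h by (subst bij_betw_cong[of _ _ h]) auto
  ultimately have "bij_betw ?g (A \<union> (B - A)) (f ` A \<union> (B - f ` A))"
    by (rule bij_betw_combine) auto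
  then show ?thesis
    using that[of ?g] assms by (simp add: Un_absorb1)
qed

text \<open>
  Choosing approval sets so that \<open>p\<close> gets exactly \<open>s\<close> points and nobody gets more is an \<open>N \<times> N\<close>
  assignment problem. Person \<open>i < n * m\<close> stands for the candidate at position \<open>i mod m\<close> of vote
  \<open>i div m\<close>; the other persons are dummies. Objects \<open>j < u\<close> mean disapproval, \<open>m - k\<close> of them for each
  vote; the others mean approval, \<open>s\<close> of them for each candidate. Forbidden pairs cost \<open>big\<close>. Since the
  dummies are allowed neither at the votes nor at \<open>p\<close>, all objects there go to real persons.
\<close>

locale assignment_reduction =
  fixes V :: "nat vote list" and m k s p big :: nat
  assumes votes: "\<And>v. v < length V \<Longrightarrow> set (V ! v) = {..<m} \<and> distinct (V ! v)"
    and k: "k < m" and s: "0 < s" and p: "p < m"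
    and room: "length V * m \<le> length V * (m - k) + m * s"
begin

abbreviation "n \<equiv> length V"
abbreviation "u \<equiv> n * (m - k)"
abbreviation "N \<equiv> u + m * s"

section \<open>Persons and objects as blocks of indices\<close>

definition cand :: "nat \<Rightarrow> nat" where
  "cand i = V ! (i div m) ! (i mod m)"

text \<open>Allowed pairs of real persons carry the two kinds of summands of
  \<open>exchange_cost\<close>, with \<open>i mod m\<close> as 0-based position. Dummies are free at
  the approval objects of candidates other than \<open>p\<close>, which is what lets those
  candidates stay below \<open>s\<close> points.\<close>

definition cost :: "nat \<Rightarrow> nat \<Rightarrow> nat" where
  "cost i j =
     (if i < n * m then
        if j < u then if j div (m - k) = i div m then k - i mod m else big
        else if (j - u) div s = cand i then i mod m - k else big
      else if j < u \<or> (j - u) div s = p then big else 0)"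

lemma m_pos: "0 < m"
  using k by simp

lemma length_vote: "v < n \<Longrightarrow> length (V ! v) = m"
  using votes[of v] distinct_card[of "V ! v"] by simp

lemma person_div: "i < n * m \<Longrightarrow> i div m < n"
  by (simp add: less_mult_imp_div_less)

lemma cand_less: "i < n * m \<Longrightarrow> cand i < m"
  using votes[of "i div m"] length_vote[of "i div m"] person_div[of i] m_pos nth_mem[of "i mod m" "V ! (i div m)"]
  by (auto simp: cand_def)

lemma cand_inj:
  assumes i: "i < n * m" and "i' < n * m" and div: "i div m = i' div m" and eq: "cand i = cand i'"
  shows "i = i'"
proof -
  have "distinct (V ! (i div m))" "length (V ! (i div m)) = m"
    using votes length_vote person_div[OF i] by blast+
  moreover have "i mod m < m" "i' mod m < m" using m_pos by simp_all
  ultimately have "i mod m = i' mod m"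
    using eq div by (simp add: cand_def nth_eq_iff_index_eq)
  then show ?thesis using div div_mult_mod_eq by metis
qed

lemma cand_surj:
  assumes "v < n" "d < m"
  obtains i where "i < n * m" "i div m = v" "cand i = d"
proof -
  have "d \<in> set (V ! v)" using votes assms by auto
  then obtain r where r: "r < m" "V ! v ! r = d"
    using length_vote[OF assms(1)] by (auto simp: in_set_conv_nth)
  have "v * m + r < Suc v * m" using r by simp
  also have "\<dots> \<le> n * m" using assms by (intro mult_le_mono1) simp
  finally have "v * m + r < n * m" .
  then show ?thesis using that[of "v * m + r"] r by (simp add: cand_def)
qed

lemma card_vote_objects: "v < n \<Longrightarrow> card {j. j < u \<and> j div (m - k) = v} = m - k"
  using k by (intro card_div_eq) auto

lemma card_candidate_objects:
  assumes "d < m"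
  shows "card {j. u \<le> j \<and> j < N \<and> (j - u) div s = d} = s"
proof -
  have "{j. u \<le> j \<and> j < N \<and> (j - u) div s = d} = (+) u ` {j. j < m * s \<and> j div s = d}"
    by (auto simp: image_iff) (metis add_diff_inverse_nat less_diff_conv2 add.commute not_le)+
  then show ?thesis
    using card_div_eq[of d m s] assms s by (simp add: card_image)
qed

context
  fixes S :: "nat \<Rightarrow> nat set"
  assumes S: "\<And>v. v < n \<Longrightarrow> S v \<subseteq> {..<m}"
begin

lemma card_unapproved:
  assumes "v < n"
  shows "card {i. i < n * m \<and> i div m = v \<and> cand i \<notin> S v} = m - card (S v)"
proof -
  have "bij_betw cand {i. i < n * m \<and> i div m = v \<and> cand i \<notin> S v} ({..<m} - S v)"
  proof (rule bij_betw_imageI)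
    show "inj_on cand {i. i < n * m \<and> i div m = v \<and> cand i \<notin> S v}"
      using cand_inj by (auto simp: inj_on_def)
    have "d \<in> cand ` {i. i < n * m \<and> i div m = v \<and> cand i \<notin> S v}" if "d < m" "d \<notin> S v" for d
      using cand_surj[OF assms that(1)] that(2) by blast
    then show "cand ` {i. i < n * m \<and> i div m = v \<and> cand i \<notin> S v} = {..<m} - S v"
      using cand_less by auto
  qed
  then show ?thesis
    using S[OF assms] by (simp add: bij_betw_same_card card_Diff_subset finite_subset)
qed

lemma card_approved:
  assumes "d < m"
  shows "card {i. i < n * m \<and> cand i = d \<and> d \<in> S (i div m)} = card {v. v < n \<and> d \<in> S v}"
proof -
  have "bij_betw (\<lambda>i. i div m) {i. i < n * m \<and> cand i = d \<and> d \<in> S (i div m)} {v. v < n \<and> d \<in> S v}"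
  proof (rule bij_betw_imageI)
    show "inj_on (\<lambda>i. i div m) {i. i < n * m \<and> cand i = d \<and> d \<in> S (i div m)}"
      using cand_inj by (auto simp: inj_on_def)
    have "v \<in> (\<lambda>i. i div m) ` {i. i < n * m \<and> cand i = d \<and> d \<in> S (i div m)}" if "v < n" "d \<in> S v" for v
      using cand_surj[OF that(1) assms] that(2) by blast
    then show "(\<lambda>i. i div m) ` {i. i < n * m \<and> cand i = d \<and> d \<in> S (i div m)} = {v. v < n \<and> d \<in> S v}"
      using person_div by auto
  qed
  then show ?thesis by (rule bij_betw_same_card)
qed

lemma sum_exchange_cost:
  "(\<Sum>i<n * m. if cand i \<in> S (i div m) then i mod m - k else k - i mod m) =
    (\<Sum>v<n. exchange_cost k (S v) (V ! v))"
proof -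
  let ?f = "\<lambda>i. if cand i \<in> S (i div m) then i mod m - k else k - i mod m"
  have "sum ?f {v * m..<v * m + m} = exchange_cost k (S v) (V ! v)" if "v < n" for v
  proof -
    have "sum ?f {v * m..<v * m + m} = (\<Sum>r<m. ?f (r + v * m))"
      using sum.shift_bounds_nat_ivl[of ?f 0 "v * m" m]
      by (simp only: lessThan_atLeast0 add_0 add.commute[of m])
    also have "\<dots> = (\<Sum>r<m. if V ! v ! r \<in> S v then r - k else k - r)"
      by (intro sum.cong) (auto simp: cand_def)
    finally show ?thesis
      using exchange_cost_nth[of "V ! v" k "S v"] votes[OF that] length_vote[OF that] by simp
  qed
  then show ?thesis
    by (subst sum.nat_group[symmetric]) simp
qed

end

text \<open>A total below \<open>big\<close> excludes every forbidden pair. The block of objects of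
  a vote, and the block of \<open>p\<close>, can then only be filled by their own real persons, and
  being filled completely they give the two equalities. In the block of any other candidate dummies
  may sit too, hence only an inequality there.\<close>

lemma assignment_imp_approval_sets:
  assumes g: "bij_betw g {..<N} {..<N}" and b: "(\<Sum>i<N. cost i (g i)) \<le> b" "b < big"
  shows "\<exists>S. (\<forall>v<n. S v \<subseteq> {..<m} \<and> card (S v) = k) \<and>
      (\<forall>d<m. card {v. v < n \<and> d \<in> S v} \<le> s) \<and> card {v. v < n \<and> p \<in> S v} = s \<and>
      (\<Sum>v<n. exchange_cost k (S v) (V ! v)) \<le> b"
proof -
  have fin: "cost i (g i) < big" if "i < N" for i
    using member_le_sum[of i "{..<N}" "\<lambda>i. cost i (g i)"] that b by auto
  have ok1: "g i div (m - k) = i div m" if "i < n * m" "g i < u" for i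
    using that room fin[of i] by (auto simp: cost_def split: if_splits)
  have ok2: "(g i - u) div s = cand i" if "i < n * m" "u \<le> g i" for i
    using that room fin[of i] by (auto simp: cost_def split: if_splits)
  have ok3: "u \<le> g i \<and> (g i - u) div s \<noteq> p" if "i < N" "n * m \<le> i" for i
    using that fin[of i] by (auto simp: cost_def split: if_splits)
  have g_less: "g i < N" if "i < N" for i
    using g that by (auto simp: bij_betw_def)
  have g_surj: "\<exists>i<N. g i = j" if "j < N" for j
  proof -
    have "j \<in> g ` {..<N}" unfolding bij_betw_imp_surj_on[OF g] using that by simp
    then show ?thesis by blast
  qed
  have g_inj: "inj_on g {..<N}" using g by (simp add: bij_betw_def)
  define S where "S v = cand ` {i. i < n * m \<and> i div m = v \<and> u \<le> g i}" for v
  have S_iff: "cand i \<in> S (i div m) \<longleftrightarrow> u \<le> g i" if "i < n * m" for i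
  proof
    assume "cand i \<in> S (i div m)"
    then obtain x where x: "x < n * m" "x div m = i div m" "u \<le> g x" "cand i = cand x"
      by (auto simp: S_def)
    then have "i = x" using cand_inj[OF that x(1)] by simp
    then show "u \<le> g i" using x by simp
  qed (use that in \<open>auto simp: S_def\<close>)
  have S: "S v \<subseteq> {..<m}" for v
    using cand_less by (auto simp: S_def)
  have "card (S v) = k" if v: "v < n" for v
  proof -
    have "g ` {i. i < n * m \<and> i div m = v \<and> cand i \<notin> S v} = {j. j < u \<and> j div (m - k) = v}"
    proof (intro equalityI subsetI)
      fix j assume "j \<in> g ` {i. i < n * m \<and> i div m = v \<and> cand i \<notin> S v}"
      then show "j \<in> {j. j < u \<and> j div (m - k) = v}"
        using S_iff ok1 by (auto simp: not_le[symmetric])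
    next
      fix j assume j: "j \<in> {j. j < u \<and> j div (m - k) = v}"
      then obtain i where i: "i < N" "g i = j" using g_surj[of j] by auto
      then have "i < n * m" using ok3[of i] j by force
      then show "j \<in> g ` {i. i < n * m \<and> i div m = v \<and> cand i \<notin> S v}"
        using i j ok1[of i] S_iff[of i] by (intro image_eqI[of _ _ i]) auto
    qed
    moreover have "inj_on g {i. i < n * m \<and> i div m = v \<and> cand i \<notin> S v}"
      using room by (intro inj_on_subset[OF g_inj]) auto
    then have "card (g ` {i. i < n * m \<and> i div m = v \<and> cand i \<notin> S v}) = m - card (S v)"
      using card_unapproved[of S, OF S v] by (simp add: card_image)
    ultimately have "m - card (S v) = m - k"
      using card_vote_objects[OF v] by simp
    moreover have "card (S v) \<le> m"
      using card_mono[OF _ S[of v]] by simp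
    ultimately show ?thesis using k by simp
  qed
  moreover have image: "g ` {i. i < n * m \<and> cand i = d \<and> d \<in> S (i div m)} \<subseteq> {j. u \<le> j \<and> j < N \<and> (j - u) div s = d}" for d
  proof
    fix j assume "j \<in> g ` {i. i < n * m \<and> cand i = d \<and> d \<in> S (i div m)}"
    then obtain i where "i < n * m" "cand i = d" "d \<in> S (i div m)" "j = g i" by blast
    then show "j \<in> {j. u \<le> j \<and> j < N \<and> (j - u) div s = d}"
      using S_iff[of i] ok2[of i] g_less[of i] room by auto
  qed
  have inj: "inj_on g {i. i < n * m \<and> cand i = d \<and> d \<in> S (i div m)}" for d
    using room by (intro inj_on_subset[OF g_inj]) auto
  have "card {v. v < n \<and> d \<in> S v} \<le> s" if "d < m" for d
    using card_mono[OF _ image[of d]] card_image[OF inj[of d]] card_candidate_objects[OF that]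
      card_approved[of S, OF S that] by simp
  moreover have "card {v. v < n \<and> p \<in> S v} = s"
  proof -
    have "{j. u \<le> j \<and> j < N \<and> (j - u) div s = p} \<subseteq> g ` {i. i < n * m \<and> cand i = p \<and> p \<in> S (i div m)}"
    proof
      fix j assume j: "j \<in> {j. u \<le> j \<and> j < N \<and> (j - u) div s = p}"
      then obtain i where i: "i < N" "g i = j" using g_surj[of j] by auto
      then have "i < n * m" using ok3[of i] j by force
      then show "j \<in> g ` {i. i < n * m \<and> cand i = p \<and> p \<in> S (i div m)}"
        using i j ok2[of i] S_iff[of i] by (intro image_eqI[of _ _ i]) auto
    qed
    then have "g ` {i. i < n * m \<and> cand i = p \<and> p \<in> S (i div m)} = {j. u \<le> j \<and> j < N \<and> (j - u) div s = p}"
      using image by blast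
    then show ?thesis
      using card_image[OF inj[of p]] card_candidate_objects[OF p] card_approved[of S, OF S p] by simp
  qed
  moreover have "(\<Sum>v<n. exchange_cost k (S v) (V ! v)) \<le> b"
  proof -
    have "(\<Sum>i<n * m. if cand i \<in> S (i div m) then i mod m - k else k - i mod m) = (\<Sum>i<n * m. cost i (g i))"
    proof (intro sum.cong refl)
      fix i assume "i \<in> {..<n * m}"
      then show "(if cand i \<in> S (i div m) then i mod m - k else k - i mod m) = cost i (g i)"
        using S_iff[of i] ok1[of i] ok2[of i] by (auto simp: cost_def)
    qed
    also have "\<dots> \<le> (\<Sum>i<N. cost i (g i))"
      using room by (intro sum_mono2) auto
    finally show ?thesis using sum_exchange_cost[of S, OF S] b by simp
  qed
  ultimately show ?thesis using S by (intro exI[of _ S]) auto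
qed

text \<open>\<open>Inl v\<close> labels disapproval in vote \<open>v\<close> and
  \<open>Inr d\<close> approval of \<open>d\<close>. Every label has at least as many objects as
  persons wishing it, so the real persons can be placed as \<open>S\<close> prescribes, and the
  dummies take what is left.\<close>

lemma approval_sets_imp_assignment:
  assumes S: "\<And>v. v < n \<Longrightarrow> S v \<subseteq> {..<m}" and card_S: "\<And>v. v < n \<Longrightarrow> card (S v) = k"
    and score: "\<And>d. d < m \<Longrightarrow> card {v. v < n \<and> d \<in> S v} \<le> s"
    and score_p: "card {v. v < n \<and> p \<in> S v} = s"
  shows "\<exists>g. bij_betw g {..<N} {..<N} \<and>
    (\<Sum>i<N. cost i (g i)) = (\<Sum>v<n. exchange_cost k (S v) (V ! v))"
proof -
  define wish where "wish i = (if cand i \<in> S (i div m) then Inr (cand i) else Inl (i div m) :: nat + nat)" for i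
  define slot where "slot j = (if j < u then Inl (j div (m - k)) else Inr ((j - u) div s) :: nat + nat)" for j
  have wish_Inl: "{i \<in> {..<n * m}. wish i = Inl v} = {i. i < n * m \<and> i div m = v \<and> cand i \<notin> S v}" for v
    by (auto simp: wish_def split: if_splits)
  have wish_Inr: "{i \<in> {..<n * m}. wish i = Inr d} = {i. i < n * m \<and> cand i = d \<and> d \<in> S (i div m)}" for d
    by (auto simp: wish_def split: if_splits)
  have slot_Inl: "{j \<in> {..<N}. slot j = Inl v} = {j. j < u \<and> j div (m - k) = v}" for v
    by (auto simp: slot_def split: if_splits)
  have slot_Inr: "{j \<in> {..<N}. slot j = Inr d} = {j. u \<le> j \<and> j < N \<and> (j - u) div s = d}" for d
    by (auto simp: slot_def split: if_splits)
  have card_Inl: "card {i \<in> {..<n * m}. wish i = Inl v} = card {j \<in> {..<N}. slot j = Inl v}" if "v < n" for v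
    unfolding wish_Inl slot_Inl using card_unapproved[of S v] S card_S that
    by (simp add: card_vote_objects)
  have card_Inr: "card {i \<in> {..<n * m}. wish i = Inr d} \<le> card {j \<in> {..<N}. slot j = Inr d}" if "d < m" for d
    unfolding wish_Inr slot_Inr using card_approved[of S d] S score that
    by (simp add: card_candidate_objects)
  have card_p: "card {i \<in> {..<n * m}. wish i = Inr p} = card {j \<in> {..<N}. slot j = Inr p}"
    unfolding wish_Inr slot_Inr using card_approved[of S p] S score_p p
    by (simp add: card_candidate_objects)
  have fibres: "card {i \<in> {..<n * m}. wish i = a} \<le> card {j \<in> {..<N}. slot j = a}" for a
  proof (cases a)
    case (Inl v)
    show ?thesis
    proof (cases "v < n")
      case False
      then have "{i \<in> {..<n * m}. wish i = Inl v} = {}"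
        unfolding wish_Inl using person_div by auto
      then show ?thesis by (simp only: Inl card.empty le0)
    qed (simp only: Inl card_Inl order_refl)
  next
    case (Inr d)
    show ?thesis
    proof (cases "d < m")
      case False
      then have "{i \<in> {..<n * m}. wish i = Inr d} = {}"
        unfolding wish_Inr using cand_less by auto
      then show ?thesis by (simp only: Inr card.empty le0)
    qed (simp only: Inr card_Inr)
  qed
  obtain f where f: "inj_on f {..<n * m}" "f ` {..<n * m} \<subseteq> {..<N}"
    and slot_f: "\<And>i. i \<in> {..<n * m} \<Longrightarrow> slot (f i) = wish i"
    using injection_between_fibres[OF _ fibres] by (metis finite_lessThan)
  have "{..<n * m} \<subseteq> {..<N}" using room by auto
  then obtain g where g: "bij_betw g {..<N} {..<N}" and gf: "\<And>i. i \<in> {..<n * m} \<Longrightarrow> g i = f i"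
    using injection_extends_to_permutation[OF _ _ f] by (metis finite_lessThan)
  \<comment> \<open>For a label with equally many wishes and objects, the real persons use up its
    objects; injectivity of \<open>g\<close> then keeps the dummies out. This applies to all votes
    and to \<open>p\<close>, so dummies cost nothing.\<close>
  have full: "slot (g i) \<noteq> a"
    if i: "n * m \<le> i" "i < N" and a: "card {i \<in> {..<n * m}. wish i = a} = card {j \<in> {..<N}. slot j = a}" for i a
  proof
    assume *: "slot (g i) = a"
    have "f ` {i \<in> {..<n * m}. wish i = a} = {j \<in> {..<N}. slot j = a}"
    proof (rule card_subset_eq)
      show "f ` {i \<in> {..<n * m}. wish i = a} \<subseteq> {j \<in> {..<N}. slot j = a}"
        using f(2) slot_f by auto
      show "card (f ` {i \<in> {..<n * m}. wish i = a}) = card {j \<in> {..<N}. slot j = a}"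
        unfolding a[symmetric] by (intro card_image inj_on_subset[OF f(1)]) auto
    qed simp
    moreover have "g i \<in> {j \<in> {..<N}. slot j = a}"
      using g i * by (auto simp: bij_betw_def)
    ultimately have "g i \<in> f ` {i \<in> {..<n * m}. wish i = a}" by simp
    then obtain i' where "i' < n * m" "g i = g i'" using gf by auto
    then show False
      using i inj_onD[OF bij_betw_imp_inj_on[OF g], of i i'] room by simp
  qed
  have "cost i (g i) = 0" if i: "n * m \<le> i" "i < N" for i
  proof -
    have "\<not> g i < u"
    proof
      assume "g i < u"
      then have "slot (g i) = Inl (g i div (m - k))" "g i div (m - k) < n"
        by (auto simp: slot_def less_mult_imp_div_less)
      then show False using full[OF i card_Inl] by blast
    qed
    moreover from this have "(g i - u) div s \<noteq> p"
      using full[OF i card_p] by (auto simp: slot_def)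
    ultimately show ?thesis using i by (simp add: cost_def)
  qed
  then have "(\<Sum>i<N. cost i (g i)) = (\<Sum>i<n * m. cost i (g i))"
    using room by (intro sum.mono_neutral_right) auto
  also have "\<dots> = (\<Sum>i<n * m. if cand i \<in> S (i div m) then i mod m - k else k - i mod m)"
  proof (intro sum.cong refl)
    fix i assume "i \<in> {..<n * m}"
    then show "cost i (g i) = (if cand i \<in> S (i div m) then i mod m - k else k - i mod m)"
      using gf[of i] slot_f[of i] by (auto simp: cost_def slot_def wish_def split: if_splits)
  qed
  finally show ?thesis using g sum_exchange_cost[of S] S by auto
qed

lemma assignment_iff_approval_sets:
  assumes "b < big"
  shows "(\<exists>g. bij_betw g {..<N} {..<N} \<and> (\<Sum>i<N. cost i (g i)) \<le> b) \<longleftrightarrow>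
    (\<exists>S. (\<forall>v<n. S v \<subseteq> {..<m} \<and> card (S v) = k) \<and>
      (\<forall>d<m. card {v. v < n \<and> d \<in> S v} \<le> s) \<and> card {v. v < n \<and> p \<in> S v} = s \<and>
      (\<Sum>v<n. exchange_cost k (S v) (V ! v)) \<le> b)"
    (is "?L \<longleftrightarrow> ?R")
proof
  show "?L \<Longrightarrow> ?R"
    using assignment_imp_approval_sets[OF _ _ assms] by blast
next
  assume ?R
  then obtain S where S: "\<And>v. v < n \<Longrightarrow> S v \<subseteq> {..<m}" "\<And>v. v < n \<Longrightarrow> card (S v) = k"
    "\<And>d. d < m \<Longrightarrow> card {v. v < n \<and> d \<in> S v} \<le> s" "card {v. v < n \<and> p \<in> S v} = s"
    and "(\<Sum>v<n. exchange_cost k (S v) (V ! v)) \<le> b"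
    by blast
  then show ?L using approval_sets_imp_assignment[OF S] by auto
qed

end


section \<open>The auction algorithm\<close>

text \<open>
  Persons \<open>0, 1, \<dots>\<close> enter one by one, \<open>nxt\<close> of them so far. Person \<open>cur\<close> is the only one among these
  without an object; it takes an object for which cost plus price is least, raises the price of that object
  by 1 and displaces the previous owner. \<open>owner j\<close> is 0 if \<open>j\<close> is free and the number of its owner
  plus 1 otherwise. The auction is over when \<open>cur = N\<close>; until then \<open>r\<close> counts the bids.
\<close>

definition auction_state ::
  "(nat \<Rightarrow> nat \<Rightarrow> nat) \<Rightarrow> nat \<Rightarrow> nat \<Rightarrow> nat \<Rightarrow> (nat \<Rightarrow> nat) \<Rightarrow> (nat \<Rightarrow> nat) \<Rightarrow> nat \<Rightarrow> nat \<Rightarrow> bool" where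
  "auction_state w N K r price owner cur nxt \<longleftrightarrow>
     (cur = N \<and> nxt = N + 1 \<or> cur < nxt \<and> nxt \<le> N) \<and>
     bij_betw (\<lambda>j. owner j - 1) {j. j < N \<and> owner j \<noteq> 0} ({..<nxt} - {cur}) \<and>
     (\<forall>j<N. price j \<le> K + 1) \<and>
     (\<forall>j<N. owner j = 0 \<longrightarrow> price j = 0) \<and>
     (\<forall>j<N. owner j \<noteq> 0 \<longrightarrow>
       (\<forall>j'<N. w (owner j - 1) j + price j \<le> w (owner j - 1) j' + price j' + 1)) \<and>
     (cur < N \<longrightarrow> (\<Sum>j<N. price j) = r)"

section \<open>Preservation of the auction invariant\<close>

lemma auction_state_init:
  assumes "\<And>j. j < N \<Longrightarrow> price j = 0" "\<And>j. j < N \<Longrightarrow> owner j = 0" "0 < N"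
  shows "auction_state w N K 0 price owner 0 1"
proof -
  have "{j. j < N \<and> owner j \<noteq> 0} = {}" using assms by auto
  then show ?thesis
    using assms unfolding auction_state_def by (simp only: bij_betw_def) (simp add: lessThan_Suc)
qed

text \<open>The object taken was optimal for the bidder before its price rose by 1, so afterwards
  the bidder is within 1 of its optimum. For the other owners the only changed alternative has
  become dearer. The displaced owner is the next bidder and leaves the slackness condition.\<close>

lemma auction_state_step:
  assumes inv: "auction_state w N K r price owner cur nxt"
    and cur: "cur < N" and j: "j < N"
    and best: "\<And>j'. j' < N \<Longrightarrow> w cur j + price j \<le> w cur j' + price j'"
    and w: "\<And>i j. i < N \<Longrightarrow> j < N \<Longrightarrow> w i j \<le> K"
  shows "auction_state w N K (Suc r) (price(j := Suc (price j))) (owner(j := Suc cur))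
    (if owner j = 0 then nxt else owner j - 1) (if owner j = 0 then Suc nxt else nxt)"
proof -
  let ?f = "\<lambda>j. owner j - 1" and ?A = "{j. j < N \<and> owner j \<noteq> 0}"
  let ?price = "price(j := Suc (price j))" and ?owner = "owner(j := Suc cur)"
  let ?cur = "if owner j = 0 then nxt else owner j - 1"
  let ?nxt = "if owner j = 0 then Suc nxt else nxt"
  have nxt: "cur < nxt" "nxt \<le> N"
    and bij: "bij_betw ?f ?A ({..<nxt} - {cur})"
    and le: "\<And>j. j < N \<Longrightarrow> price j \<le> K + 1"
    and free: "\<And>j. j < N \<Longrightarrow> owner j = 0 \<Longrightarrow> price j = 0"
    and slack: "\<And>j j'. j < N \<Longrightarrow> owner j \<noteq> 0 \<Longrightarrow> j' < N \<Longrightarrow>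
       w (owner j - 1) j + price j \<le> w (owner j - 1) j' + price j' + 1"
    and sum: "(\<Sum>j<N. price j) = r"
    using inv cur unfolding auction_state_def by auto
  have f_mem: "?f j \<in> {..<nxt} - {cur}" if "owner j \<noteq> 0"
    using bij that j by (auto simp: bij_betw_def)
  have bij': "bij_betw (\<lambda>j. ?owner j - 1) {i. i < N \<and> ?owner i \<noteq> 0} ({..<?nxt} - {?cur})"
  proof -
    \<comment> \<open>Who owns something apart from the new bidder: if \<open>j\<close> was free,
      nobody lost anything and \<open>nxt\<close> merely enters; otherwise the old owner of
      \<open>j\<close> drops out.\<close>
    have "bij_betw ?f (?A - {j}) ({..<?nxt} - {?cur, cur})"
    proof (cases "owner j = 0")
      case True
      then have "?A - {j} = ?A" "{..<?nxt} - {?cur, cur} = {..<nxt} - {cur}"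
        using nxt by auto
      then show ?thesis using bij by simp
    next
      case False
      then have "bij_betw ?f (?A - {j}) ({..<nxt} - {cur} - {?f j})"
        using bij j by (intro bij_betw_DiffI) (auto simp: bij_betw_def)
      moreover have "{..<?nxt} - {?cur, cur} = {..<nxt} - {cur} - {?f j}"
        using False by auto
      ultimately show ?thesis by simp
    qed
    then have "bij_betw (\<lambda>j. ?owner j - 1) (?A - {j}) ({..<?nxt} - {?cur, cur})"
      by (subst bij_betw_cong[of _ _ ?f]) auto
    then have "bij_betw (\<lambda>j. ?owner j - 1) ((?A - {j}) \<union> {j}) (({..<?nxt} - {?cur, cur}) \<union> {?owner j - 1})"
      by (intro notIn_Un_bij_betw) auto
    moreover have "(?A - {j}) \<union> {j} = {i. i < N \<and> ?owner i \<noteq> 0}"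
      using j by auto
    moreover have "({..<?nxt} - {?cur, cur}) \<union> {?owner j - 1} = {..<?nxt} - {?cur}"
      using nxt f_mem by (cases "owner j = 0") auto
    ultimately show ?thesis by simp
  qed
  \<comment> \<open>A free object still has price 0, so nobody bids for an object of price above \<open>K\<close>.\<close>
  have "\<exists>j0<N. owner j0 = 0"
  proof (rule ccontr)
    assume "\<not> (\<exists>j0<N. owner j0 = 0)"
    then have "?A = {..<N}" by auto
    then have "card {..<N} = card ({..<nxt} - {cur})"
      using bij_betw_same_card[OF bij] by simp
    then show False using nxt by (simp add: card_Diff_singleton_if)
  qed
  then obtain j0 where j0: "j0 < N" "owner j0 = 0" by blast
  then have bound: "price j \<le> K"
    using best[OF j0(1)] free[OF j0] w[OF cur j0(1)] by simp
  have "(\<Sum>i<N. ?price i) = Suc r"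
  proof -
    have "(\<Sum>i<N. ?price i) = ?price j + (\<Sum>i\<in>{..<N} - {j}. ?price i)"
      using j by (intro sum.remove) auto
    also have "(\<Sum>i\<in>{..<N} - {j}. ?price i) = (\<Sum>i\<in>{..<N} - {j}. price i)"
      by (intro sum.cong) auto
    also have "?price j + \<dots> = Suc (price j + \<dots>)" by simp
    also have "price j + (\<Sum>i\<in>{..<N} - {j}. price i) = (\<Sum>i<N. price i)"
      using j by (intro sum.remove[symmetric]) auto
    finally show ?thesis using sum by simp
  qed
  \<comment> \<open>When a free object is taken while \<open>nxt = N\<close>, the fictitious person
    \<open>N\<close> becomes current; this encodes the end of the auction.\<close>
  moreover have "?cur = N \<and> ?nxt = N + 1 \<or> ?cur < ?nxt \<and> ?nxt \<le> N"
    using nxt f_mem by auto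
  moreover have "w (?owner i - 1) i + ?price i \<le> w (?owner i - 1) i' + ?price i' + 1"
    if "i < N" "?owner i \<noteq> 0" "i' < N" for i i'
    using that best[of i'] slack[of i i'] by (cases "i = j"; cases "i' = j") auto
  moreover have "?price i \<le> K + 1" "?owner i = 0 \<Longrightarrow> ?price i = 0" if "i < N" for i
    using le free bound that by auto
  ultimately show ?thesis
    unfolding auction_state_def using bij' by blast
qed

text \<open>While the auction runs, bids are counted by the sum of the prices, and each price is at
  most \<open>K + 1\<close>.\<close>

lemma auction_state_finished:
  assumes "auction_state w N K r price owner cur nxt" "N * (K + 1) < r"
  shows "\<not> cur < N"
proof
  assume "cur < N"
  then have "r = (\<Sum>j<N. price j)" "\<And>j. j < N \<Longrightarrow> price j \<le> K + 1"
    using assms(1) by (auto simp: auction_state_def)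
  then have "r \<le> N * (K + 1)"
    using sum_bounded_above[of "{..<N}" price "K + 1"] by simp
  then show False using assms(2) by simp
qed

text \<open>The counter \<open>r\<close> is tied to the prices only while the auction runs, so
  surplus rounds may advance it freely.\<close>

lemma auction_state_idle:
  "auction_state w N K r price owner cur nxt \<Longrightarrow> \<not> cur < N \<Longrightarrow> auction_state w N K r' price owner cur nxt"
  unfolding auction_state_def by simp

lemma auction_state_owner_less:
  assumes "auction_state w N K r price owner cur nxt" "\<not> cur < N" "j < N"
  shows "owner j - 1 < N"
proof (cases "owner j = 0")
  case False
  have "bij_betw (\<lambda>j. owner j - 1) {j. j < N \<and> owner j \<noteq> 0} ({..<nxt} - {cur})" "cur = N" "nxt = N + 1"
    using assms by (auto simp: auction_state_def)
  then show ?thesis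
    using bij_betwE[of "\<lambda>j. owner j - 1" "{j. j < N \<and> owner j \<noteq> 0}" "{..<nxt} - {cur}"] False assms(3)
    by fastforce
qed (use assms(3) in simp)

text \<open>
  At the end every person pays at most 1 more than its optimum at the given prices, so the assignment
  is optimal up to an error of \<open>N\<close>. As all costs are multiples of \<open>N + 1\<close>, the error is 0.
\<close>

lemma auction_state_optimal:
  fixes c :: "nat \<Rightarrow> nat \<Rightarrow> nat"
  assumes inv: "auction_state (\<lambda>i j. c i j * (N + 1)) N K r price owner cur nxt" and fin: "\<not> cur < N"
  shows "(\<Sum>j<N. c (owner j - 1) j) \<le> b \<longleftrightarrow>
    (\<exists>g. bij_betw g {..<N} {..<N} \<and> (\<Sum>i<N. c i (g i)) \<le> b)"
proof -
  let ?f = "\<lambda>j. owner j - 1" and ?A = "{j. j < N \<and> owner j \<noteq> 0}"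
  have "cur = N" "nxt = N + 1"
    and bij: "bij_betw ?f ?A ({..<nxt} - {cur})"
    and slack: "\<And>j j'. j < N \<Longrightarrow> owner j \<noteq> 0 \<Longrightarrow> j' < N \<Longrightarrow>
       c (?f j) j * (N + 1) + price j \<le> c (?f j) j' * (N + 1) + price j' + 1"
    using inv fin unfolding auction_state_def by auto
  then have bij: "bij_betw ?f ?A {..<N}"
    using \<open>cur = N\<close> by (simp add: lessThan_Suc)
  have "card ?A = card {..<N}"
    using bij_betw_same_card[OF bij] .
  then have A: "?A = {..<N}"
    by (intro card_subset_eq) auto
  with bij have bij: "bij_betw ?f {..<N} {..<N}" by simp
  have opt: "(\<Sum>j<N. c (?f j) j) \<le> (\<Sum>i<N. c i (g i))" if g: "bij_betw g {..<N} {..<N}" for g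
  proof -
    have gf: "bij_betw (g \<circ> ?f) {..<N} {..<N}"
      using bij g by (rule bij_betw_trans)
    have "c (?f j) j * (N + 1) + price j \<le> c (?f j) (g (?f j)) * (N + 1) + price (g (?f j)) + 1"
      if "j < N" for j
    proof (rule slack)
      show "j < N" by fact
      then have "j \<in> ?A" using A by blast
      then show "owner j \<noteq> 0" by simp
      show "g (?f j) < N" using bij_betwE[OF gf] that by auto
    qed
    then have "(\<Sum>j<N. c (?f j) j * (N + 1) + price j) \<le>
        (\<Sum>j<N. c (?f j) (g (?f j)) * (N + 1) + price (g (?f j)) + 1)"
      by (intro sum_mono) auto
    also have "\<dots> = (\<Sum>j<N. c (?f j) (g (?f j))) * (N + 1) + (\<Sum>j<N. price ((g \<circ> ?f) j)) + N"
      by (simp only: sum.distrib flip: sum_distrib_right) simp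
    \<comment> \<open>Both assignments use every object exactly once, so the prices on the two sides
      cancel.\<close>
    also have "(\<Sum>j<N. price ((g \<circ> ?f) j)) = (\<Sum>j<N. price j)"
      using gf by (rule sum.reindex_bij_betw)
    also have "(\<Sum>j<N. c (?f j) (g (?f j))) = (\<Sum>i<N. c i (g i))"
      using bij by (rule sum.reindex_bij_betw[where g = "\<lambda>i. c i (g i)"])
    finally have "(\<Sum>j<N. c (?f j) j) * (N + 1) \<le> (\<Sum>i<N. c i (g i)) * (N + 1) + N"
      by (simp add: sum.distrib flip: sum_distrib_right)
    also have "\<dots> < ((\<Sum>i<N. c i (g i)) + 1) * (N + 1)"
      by simp
    finally show ?thesis by (simp only: mult_less_cancel2) simp
  qed
  have "\<exists>g. bij_betw g {..<N} {..<N} \<and> (\<Sum>i<N. c i (g i)) = (\<Sum>j<N. c (?f j) j)"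
  proof (intro exI conjI)
    let ?g = "inv_into {..<N} ?f"
    show "bij_betw ?g {..<N} {..<N}" using bij by (rule bij_betw_inv_into)
    have "(\<Sum>j<N. c (?f j) (?g (?f j))) = (\<Sum>i<N. c i (?g i))"
      using bij by (rule sum.reindex_bij_betw[where g = "\<lambda>i. c i (?g i)"])
    moreover have "(\<Sum>j<N. c (?f j) (?g (?f j))) = (\<Sum>j<N. c (?f j) j)"
      using bij_betw_inv_into_left[OF bij] by (intro sum.cong) auto
    ultimately show "(\<Sum>i<N. c i (?g i)) = (\<Sum>j<N. c (?f j) j)" by simp
  qed
  then show ?thesis using opt le_trans by metis
qed


section \<open>Total correctness with time bounds\<close>

text \<open>A bound on the running time if every loop is iterated at most \<open>M\<close> times whenever it is reached.\<close>

primrec time_bound :: "prog \<Rightarrow> nat \<Rightarrow> nat" where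
  "time_bound Skip M = 1"
| "time_bound (Write x e d) M = expr_time e + expr_time d + 1"
| "time_bound (Seq P Q) M = time_bound P M + time_bound Q M"
| "time_bound (If e P Q) M = expr_time e + time_bound P M + time_bound Q M + 1"
| "time_bound (While e P) M = M * (expr_time e + time_bound P M + 1) + expr_time e + 1"

lemma time_bound_poly: "\<exists>q :: nat poly. \<forall>M. poly q M = time_bound P M"
proof (induction P)
  case Skip
  show ?case by (rule exI[of _ "[:1:]"]) simp
next
  case (Write x e d)
  show ?case by (rule exI[of _ "[:expr_time e + expr_time d + 1:]"]) simp
next
  case (Seq P Q)
  then obtain p q where "\<forall>M. poly p M = time_bound P M" "\<forall>M. poly q M = time_bound Q M" by blast
  then show ?case by (intro exI[of _ "p + q"]) simp
next
  case (If e P Q)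
  then obtain p q where "\<forall>M. poly p M = time_bound P M" "\<forall>M. poly q M = time_bound Q M" by blast
  then show ?case by (intro exI[of _ "[:expr_time e + 1:] + p + q"]) simp
next
  case (While e P)
  then obtain p where "\<forall>M. poly p M = time_bound P M" by blast
  then show ?case
    by (intro exI[of _ "[:0, 1:] * ([:expr_time e + 1:] + p) + [:expr_time e + 1:]"]) simp
qed

section \<open>Frame conditions and proof rules for programs\<close>

primrec vars :: "expr \<Rightarrow> nat set" where
  "vars (Const n) = {}"
| "vars (Read x e) = insert x (vars e)"
| "vars (Add e d) = vars e \<union> vars d"
| "vars (Sub e d) = vars e \<union> vars d"

primrec writes :: "prog \<Rightarrow> nat set" where
  "writes Skip = {}"
| "writes (Write x e d) = {x}"
| "writes (Seq P Q) = writes P \<union> writes Q"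
| "writes (If e P Q) = writes P \<union> writes Q"
| "writes (While e P) = writes P"

lemma expr_value_cong: "(\<And>x. x \<in> vars e \<Longrightarrow> \<tau> x = \<sigma> x) \<Longrightarrow> expr_value e \<tau> = expr_value e \<sigma>"
  by (induction e) auto

text \<open>Dependence is tracked for whole arrays, not cells. This suffices because each scalar
  variable has an array of its own.\<close>

lemma run_frame: "run P \<sigma> t \<tau> \<Longrightarrow> x \<notin> writes P \<Longrightarrow> \<tau> x = \<sigma> x"
  by (induction rule: run.induct) auto

definition put :: "nat \<Rightarrow> nat \<Rightarrow> nat \<Rightarrow> store \<Rightarrow> store" where
  "put x i v \<sigma> = \<sigma>(x := (\<sigma> x)(i := v))"

lemma put_same [simp]: "put x i v \<sigma> x = (\<sigma> x)(i := v)"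
  by (simp add: put_def)

lemma put_other [simp]: "y \<noteq> x \<Longrightarrow> put x i v \<sigma> y = \<sigma> y"
  by (simp add: put_def)

text \<open>
  Total correctness within the time bound; the rules for loops are responsible for the number of
  iterations being at most \<open>M\<close>.
\<close>

definition wp :: "nat \<Rightarrow> prog \<Rightarrow> (store \<Rightarrow> bool) \<Rightarrow> store \<Rightarrow> bool" where
  "wp M P Q \<sigma> \<longleftrightarrow> (\<exists>t \<tau>. run P \<sigma> t \<tau> \<and> t \<le> time_bound P M \<and> Q \<tau>)"

lemma wp_Skip: "Q \<sigma> \<Longrightarrow> wp M Skip Q \<sigma>"
  using run.Skip by (auto simp: wp_def)

lemma wp_Write: "Q (put x (expr_value e \<sigma>) (expr_value d \<sigma>) \<sigma>) \<Longrightarrow> wp M (Write x e d) Q \<sigma>"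
  unfolding wp_def put_def using run.Write[of x e d \<sigma>] by fastforce

lemma wp_Seq: "wp M P (wp M P' Q) \<sigma> \<Longrightarrow> wp M (Seq P P') Q \<sigma>"
  unfolding wp_def by (fastforce intro: run.Seq add_mono)

lemma wp_If:
  assumes "expr_value e \<sigma> \<noteq> 0 \<Longrightarrow> wp M P Q \<sigma>" "expr_value e \<sigma> = 0 \<Longrightarrow> wp M P' Q \<sigma>"
  shows "wp M (If e P P') Q \<sigma>"
proof (cases "expr_value e \<sigma> = 0")
  case True
  then obtain t \<tau> where "run P' \<sigma> t \<tau>" "t \<le> time_bound P' M" "Q \<tau>"
    using assms by (auto simp: wp_def)
  then show ?thesis
    unfolding wp_def using run.If_False[OF True, of P' t \<tau> P]
    by (intro exI[of _ "expr_time e + t + 1"] exI[of _ \<tau>]) auto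
next
  case False
  then obtain t \<tau> where "run P \<sigma> t \<tau>" "t \<le> time_bound P M" "Q \<tau>"
    using assms by (auto simp: wp_def)
  then show ?thesis
    unfolding wp_def using run.If_True[OF False, of P t \<tau> P']
    by (intro exI[of _ "expr_time e + t + 1"] exI[of _ \<tau>]) auto
qed

lemma wp_mono: "wp M P Q \<sigma> \<Longrightarrow> (\<And>\<tau>. Q \<tau> \<Longrightarrow> R \<tau>) \<Longrightarrow> wp M P R \<sigma>"
  by (auto simp: wp_def)

lemma wp_frame:
  assumes "wp M P Q \<sigma>" "\<And>\<tau>. Q \<tau> \<Longrightarrow> (\<And>x. x \<notin> writes P \<Longrightarrow> \<tau> x = \<sigma> x) \<Longrightarrow> R \<tau>"
  shows "wp M P R \<sigma>"
  using assms run_frame unfolding wp_def by blast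

text \<open>The invariant is indexed by the rounds done and their number \<open>n\<close> is fixed
  beforehand. With \<open>i\<close> rounds done, \<open>n - i\<close> rounds of uniformly bounded
  time remain, hence the induction downwards from \<open>n\<close>.\<close>

lemma wp_While:
  assumes start: "I 0 \<sigma>" and n: "n \<le> M"
    and step: "\<And>i \<tau>. i < n \<Longrightarrow> I i \<tau> \<Longrightarrow> expr_value e \<tau> \<noteq> 0 \<and> wp M P (I (Suc i)) \<tau>"
    and stop: "\<And>\<tau>. I n \<tau> \<Longrightarrow> expr_value e \<tau> = 0 \<and> Q \<tau>"
  shows "wp M (While e P) Q \<sigma>"
proof -
  have "\<exists>t \<tau>. run (While e P) \<sigma> t \<tau> \<and>
      t \<le> (n - i) * (expr_time e + time_bound P M + 1) + expr_time e + 1 \<and> Q \<tau>"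
    if "i \<le> n" "I i \<sigma>" for i \<sigma>
    using that
  proof (induction i arbitrary: \<sigma> rule: inc_induct)
    case base
    then show ?case
      using stop[OF base] run.While_False[of e \<sigma> P]
      by (intro exI[of _ "expr_time e + 1"] exI[of _ \<sigma>]) auto
  next
    case (step i)
    then obtain t \<tau> where e: "expr_value e \<sigma> \<noteq> 0" and t: "run P \<sigma> t \<tau>" "t \<le> time_bound P M" "I (Suc i) \<tau>"
      using assms(3) by (force simp: wp_def)
    obtain t' \<tau>' where t': "run (While e P) \<tau> t' \<tau>'"
      "t' \<le> (n - Suc i) * (expr_time e + time_bound P M + 1) + expr_time e + 1" "Q \<tau>'"
      using step.IH[OF t(3)] by blast
    have "n - i = Suc (n - Suc i)" using step.hyps by simp
    then show ?case
      using run.While_True[OF e t(1) t'(1)] t(2) t'(2,3)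
      by (intro exI[of _ "expr_time e + t + t' + 1"] exI[of _ \<tau>']) simp
  qed
  from this[of 0 \<sigma>] start obtain t \<tau> where "run (While e P) \<sigma> t \<tau>" "Q \<tau>"
    "t \<le> n * (expr_time e + time_bound P M + 1) + expr_time e + 1"
    by auto
  moreover have "n * (expr_time e + time_bound P M + 1) \<le> M * (expr_time e + time_bound P M + 1)"
    using n by (rule mult_le_mono1)
  ultimately show ?thesis unfolding wp_def by fastforce
qed

section \<open>Counting loops, multiplication and division\<close>

abbreviation var :: "nat \<Rightarrow> expr" where
  "var x \<equiv> Read x (Const 0)"

abbreviation assign :: "nat \<Rightarrow> expr \<Rightarrow> prog" (infix "::=" 61) where
  "x ::= e \<equiv> Write x (Const 0) e"

notation Seq (infixr ";;" 60)

definition for_loop :: "nat \<Rightarrow> expr \<Rightarrow> prog \<Rightarrow> prog" where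
  "for_loop x e P = (x ::= Const 0;; While (Sub e (var x)) (P;; x ::= Add (var x) (Const 1)))"

lemma writes_for_loop [simp]: "writes (for_loop x e P) = insert x (writes P)"
  by (auto simp: for_loop_def)

text \<open>The guard evaluates \<open>e\<close> anew in each round, so the body must not write its
  arrays. The body may use the frame relative to the store before the loop; \<open>I\<close> need
  only mention what changes.\<close>

lemma wp_for_loop:
  assumes x: "x \<notin> writes P" "vars e \<inter> insert x (writes P) = {}"
    and n: "expr_value e \<sigma> = n" "n \<le> M"
    and start: "I 0 (put x 0 0 \<sigma>)"
    and step: "\<And>i \<tau>. i < n \<Longrightarrow> I i \<tau> \<Longrightarrow> \<tau> x 0 = i \<Longrightarrow>
      (\<And>y. y \<notin> insert x (writes P) \<Longrightarrow> \<tau> y = \<sigma> y) \<Longrightarrow>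
      wp M P (\<lambda>\<tau>'. I (Suc i) (put x 0 (Suc i) \<tau>')) \<tau>"
    and stop: "\<And>\<tau>. I n \<tau> \<Longrightarrow> \<tau> x 0 = n \<Longrightarrow> (\<And>y. y \<notin> insert x (writes P) \<Longrightarrow> \<tau> y = \<sigma> y) \<Longrightarrow> Q \<tau>"
  shows "wp M (for_loop x e P) Q \<sigma>"
proof -
  define J where "J i \<tau> \<longleftrightarrow> I i \<tau> \<and> \<tau> x 0 = i \<and> (\<forall>y. y \<notin> insert x (writes P) \<longrightarrow> \<tau> y = \<sigma> y)" for i \<tau>
  have e: "expr_value e \<tau> = n" if "J i \<tau>" for i \<tau>
    using that x(2) n(1) by (subst expr_value_cong[of e \<tau> \<sigma>]) (auto simp: J_def)
  have "wp M (While (Sub e (var x)) (P;; x ::= Add (var x) (Const 1))) Q (put x 0 0 \<sigma>)"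
  proof (rule wp_While[where I = J, OF _ n(2)])
    show "J 0 (put x 0 0 \<sigma>)" using start by (simp add: J_def)
  next
    fix i \<tau> assume i: "i < n" and J: "J i \<tau>"
    have "wp M P (\<lambda>\<tau>'. I (Suc i) (put x 0 (Suc i) \<tau>')) \<tau>"
      using J by (intro step i) (auto simp: J_def)
    then have "wp M P (wp M (x ::= Add (var x) (Const 1)) (J (Suc i))) \<tau>"
    proof (rule wp_frame)
      fix \<tau>' assume I: "I (Suc i) (put x 0 (Suc i) \<tau>')"
        and frame: "\<And>y. y \<notin> writes P \<Longrightarrow> \<tau>' y = \<tau> y"
      have "\<tau>' x 0 = i" using frame[OF x(1)] J by (simp add: J_def)
      then have "J (Suc i) (put x 0 (Suc (\<tau>' x 0)) \<tau>')"
        using I frame J by (auto simp: J_def)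
      then show "wp M (x ::= Add (var x) (Const 1)) (J (Suc i)) \<tau>'"
        by (intro wp_Write) simp
    qed
    then show "expr_value (Sub e (var x)) \<tau> \<noteq> 0 \<and> wp M (P;; x ::= Add (var x) (Const 1)) (J (Suc i)) \<tau>"
      using e[OF J] J i by (auto simp: J_def intro: wp_Seq)
  next
    fix \<tau> assume J: "J n \<tau>"
    then show "expr_value (Sub e (var x)) \<tau> = 0 \<and> Q \<tau>"
      using e[OF J] stop[of \<tau>] by (auto simp: J_def)
  qed
  then show ?thesis
    unfolding for_loop_def by (intro wp_Seq wp_Write) simp
qed

text \<open>Repeated addition, as the machine cannot multiply. Only the first factor counts
  iterations and has to be at most \<open>M\<close>.\<close>

definition mul :: "nat \<Rightarrow> nat \<Rightarrow> expr \<Rightarrow> expr \<Rightarrow> prog" where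
  "mul z x e d = (z ::= Const 0;; for_loop x e (z ::= Add (var z) d))"

lemma writes_mul [simp]: "writes (mul z x e d) = {z, x}"
  by (auto simp: mul_def)

lemma wp_mul:
  assumes Q: "Q (put z 0 (expr_value e \<sigma> * expr_value d \<sigma>) (put x 0 (expr_value e \<sigma>) \<sigma>))"
    and M: "expr_value e \<sigma> \<le> M"
    and x: "x \<noteq> z" "(vars e \<union> vars d) \<inter> {x, z} = {}"
  shows "wp M (mul z x e d) Q \<sigma>"
proof -
  let ?\<sigma> = "put z 0 0 \<sigma>"
  have eq: "expr_value e ?\<sigma> = expr_value e \<sigma>" "expr_value d ?\<sigma> = expr_value d \<sigma>"
    using x by (auto intro!: expr_value_cong put_other)
  have "wp M (for_loop x e (z ::= Add (var z) d)) Q ?\<sigma>"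
  proof (rule wp_for_loop[where I = "\<lambda>i \<tau>. \<tau> = put z 0 (i * expr_value d \<sigma>) (put x 0 i \<sigma>)"])
    show "put x 0 0 ?\<sigma> = put z 0 (0 * expr_value d \<sigma>) (put x 0 0 \<sigma>)"
      using x by (auto simp: put_def fun_eq_iff)
  next
    fix i \<tau>
    assume \<tau>: "\<tau> = put z 0 (i * expr_value d \<sigma>) (put x 0 i \<sigma>)"
    have d: "expr_value d \<tau> = expr_value d \<sigma>"
      using x by (auto simp: \<tau> put_def intro!: expr_value_cong)
    show "wp M (z ::= Add (var z) d)
        (\<lambda>\<tau>'. put x 0 (Suc i) \<tau>' = put z 0 (Suc i * expr_value d \<sigma>) (put x 0 (Suc i) \<sigma>)) \<tau>"
      using x d by (intro wp_Write) (auto simp: \<tau> put_def fun_eq_iff)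
  next
    fix \<tau> assume "\<tau> = put z 0 (expr_value e \<sigma> * expr_value d \<sigma>) (put x 0 (expr_value e \<sigma>) \<sigma>)"
    then show "Q \<tau>" using Q by simp
  qed (use x M eq in auto)
  then show ?thesis unfolding mul_def by (intro wp_Seq wp_Write) simp
qed

text \<open>Repeated subtraction. As subtraction is truncated, the guard \<open>r + 1 - d\<close> is
  nonzero exactly if \<open>d\<close> still fits into \<open>r\<close>.\<close>

definition divmod :: "nat \<Rightarrow> nat \<Rightarrow> expr \<Rightarrow> expr \<Rightarrow> prog" where
  "divmod q r e d = (q ::= Const 0;; r ::= e;;
     While (Sub (Add (var r) (Const 1)) d) (r ::= Sub (var r) d;; q ::= Add (var q) (Const 1)))"

lemma writes_divmod [simp]: "writes (divmod q r e d) = {q, r}"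
  by (auto simp: divmod_def)

lemma wp_divmod:
  assumes Q: "Q (put r 0 (expr_value e \<sigma> mod expr_value d \<sigma>) (put q 0 (expr_value e \<sigma> div expr_value d \<sigma>) \<sigma>))"
    and M: "expr_value e \<sigma> \<le> M" and d: "0 < expr_value d \<sigma>"
    and q: "q \<noteq> r" "(vars e \<union> vars d) \<inter> {q, r} = {}"
  shows "wp M (divmod q r e d) Q \<sigma>"
proof -
  let ?e = "expr_value e \<sigma>" and ?d = "expr_value d \<sigma>"
  define S where "S i = put r 0 (?e - i * ?d) (put q 0 i \<sigma>)" for i
  have d_S: "expr_value d (S i) = ?d" for i
    using q by (auto simp: S_def put_def intro!: expr_value_cong)
  have "wp M (While (Sub (Add (var r) (Const 1)) d) (r ::= Sub (var r) d;; q ::= Add (var q) (Const 1))) Q (S 0)"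
  proof (rule wp_While[where I = "\<lambda>i \<tau>. \<tau> = S i" and n = "?e div ?d"])
    show "?e div ?d \<le> M" using M div_le_dividend le_trans by blast
  next
    fix i \<tau> assume i: "i < ?e div ?d" and \<tau>: "\<tau> = S i"
    have "Suc i * ?d \<le> ?e div ?d * ?d"
      using i by (intro mult_le_mono1) simp
    also have "\<dots> \<le> ?e" by simp
    finally have le: "?d + i * ?d \<le> ?e" by simp
    have "put q 0 (Suc i) (put r 0 (?e - i * ?d - ?d) (S i)) = S (Suc i)"
      using q le by (auto simp: S_def put_def fun_eq_iff)
    then have "wp M (r ::= Sub (var r) d;; q ::= Add (var q) (Const 1)) (\<lambda>\<tau>. \<tau> = S (Suc i)) \<tau>"
      using q d_S[of i] by (intro wp_Seq wp_Write) (simp add: \<tau>, simp add: S_def)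
    then show "expr_value (Sub (Add (var r) (Const 1)) d) \<tau> \<noteq> 0 \<and>
        wp M (r ::= Sub (var r) d;; q ::= Add (var q) (Const 1)) (\<lambda>\<tau>. \<tau> = S (Suc i)) \<tau>"
      using le d_S[of i] by (simp add: \<tau>) (simp add: S_def)
  next
    fix \<tau> assume \<tau>: "\<tau> = S (?e div ?d)"
    have mod: "?e - ?e div ?d * ?d = ?e mod ?d" by (simp add: minus_div_mult_eq_mod)
    have "Q \<tau>" using Q by (simp add: \<tau> S_def mod)
    moreover have "?e mod ?d < ?d" using d by simp
    ultimately show "expr_value (Sub (Add (var r) (Const 1)) d) \<tau> = 0 \<and> Q \<tau>"
      using d_S[of "?e div ?d"] by (simp add: \<tau>) (simp add: S_def mod)
  qed simp
  moreover have "expr_value e (put q 0 0 \<sigma>) = ?e"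
    using q by (auto intro!: expr_value_cong put_other)
  ultimately show ?thesis
    unfolding divmod_def by (intro wp_Seq wp_Write) (simp add: S_def)
qed


section \<open>The program\<close>

abbreviation (input) "num_expr \<equiv> Read 0 (Const 0)"
abbreviation (input) "votes_expr \<equiv> Read 0 (Const 1)"
abbreviation (input) "k_expr \<equiv> Read 0 (Const 2)"
abbreviation (input) "p_expr \<equiv> Read 0 (Const 3)"
abbreviation (input) "budget_expr \<equiv> Read 0 (Const 4)"
text \<open>The input consists of five header numbers followed by the votes, so this is
  \<open>n * m\<close>, obtained without multiplying.\<close>

abbreviation (input) "persons_expr \<equiv> Sub (Read 1 (Const 0)) (Const 5)"

text \<open>Scalar variables are arrays of which only cell 0 is used.\<close>

abbreviation (input) "u_var \<equiv> 2 :: nat"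
abbreviation (input) "s_var \<equiv> 3 :: nat"
abbreviation (input) "N_var \<equiv> 4 :: nat"
abbreviation (input) "big_var \<equiv> 5 :: nat"
abbreviation (input) "i_var \<equiv> 6 :: nat"
abbreviation (input) "j_var \<equiv> 7 :: nat"
abbreviation (input) "cost_var \<equiv> 8 :: nat"
abbreviation (input) "a_var \<equiv> 9 :: nat"
abbreviation (input) "b_var \<equiv> 10 :: nat"
abbreviation (input) "price_arr \<equiv> 11 :: nat"
abbreviation (input) "owner_arr \<equiv> 12 :: nat"
abbreviation (input) "cur_var \<equiv> 13 :: nat"
abbreviation (input) "nxt_var \<equiv> 14 :: nat"
abbreviation (input) "w_var \<equiv> 15 :: nat"
abbreviation (input) "best_var \<equiv> 16 :: nat"
abbreviation (input) "arg_var \<equiv> 17 :: nat"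
abbreviation (input) "t_var \<equiv> 18 :: nat"
abbreviation (input) "rounds_var \<equiv> 19 :: nat"
abbreviation (input) "total_var \<equiv> 20 :: nat"
abbreviation (input) "limit_var \<equiv> 21 :: nat"
abbreviation (input) "q_var \<equiv> 22 :: nat"
abbreviation (input) "answer_var \<equiv> 23 :: nat"
abbreviation (input) "c_var \<equiv> 24 :: nat"
abbreviation (input) "r_var \<equiv> 26 :: nat"
abbreviation (input) "d_var \<equiv> 25 :: nat"

section \<open>Programs for the auction at one score\<close>

definition neq :: "expr \<Rightarrow> expr \<Rightarrow> expr" where
  "neq e d = Add (Sub e d) (Sub d e)"

lemma expr_value_neq [simp]: "expr_value (neq e d) \<sigma> = 0 \<longleftrightarrow> expr_value e \<sigma> = expr_value d \<sigma>"
  by (auto simp: neq_def)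

text \<open>Costs are recomputed on demand. The candidate of a real person \<open>i\<close> is
  simply the input cell \<open>i + 5\<close>, since the votes are stored one after the
  other.\<close>

definition cost_prog :: prog where
  "cost_prog =
     If (Sub persons_expr (var i_var))
       (divmod a_var b_var (var i_var) num_expr;;
        If (Sub (var u_var) (var j_var))
          (divmod c_var d_var (var j_var) (Sub num_expr k_expr);;
           If (neq (var c_var) (var a_var))
             (cost_var ::= var big_var)
             (cost_var ::= Sub k_expr (var b_var)))
          (divmod c_var d_var (Sub (var j_var) (var u_var)) (var s_var);;
           If (neq (var c_var) (Read 0 (Add (var i_var) (Const 5))))
             (cost_var ::= var big_var)
             (cost_var ::= Sub (var b_var) k_expr)))
       (If (Sub (var u_var) (var j_var))
          (cost_var ::= var big_var)
          (divmod c_var d_var (Sub (var j_var) (var u_var)) (var s_var);;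
           If (neq (var c_var) p_expr)
             (cost_var ::= Const 0)
             (cost_var ::= var big_var)))"

lemma writes_cost_prog [simp]: "writes cost_prog = {a_var, b_var, c_var, d_var, cost_var}"
  by (auto simp: cost_prog_def)

definition best_prog :: prog where
  "best_prog =
     for_loop j_var (var N_var)
       (cost_prog;;
        mul w_var t_var (var cost_var) (Add (var N_var) (Const 1));;
        w_var ::= Add (var w_var) (Read price_arr (var j_var));;
        If (Add (Sub (Const 1) (var j_var)) (Sub (var best_var) (var w_var))) \<comment> \<open>\<open>j = 0 \<or> w < best\<close>\<close>
          (best_var ::= var w_var;; arg_var ::= var j_var)
          Skip)"

lemma writes_best_prog [simp]: "writes best_prog =
    {a_var, b_var, c_var, d_var, cost_var, j_var, w_var, t_var, best_var, arg_var}"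
  by (auto simp: best_prog_def)

text \<open>The current person is overwritten before the new owner is recorded, so the bidder is
  kept in \<open>i_var\<close>, where \<open>cost_prog\<close> expects it as well.\<close>

definition bid_prog :: prog where
  "bid_prog =
     If (Sub (var N_var) (var cur_var))
       (i_var ::= var cur_var;;
        best_prog;;
        If (Read owner_arr (var arg_var))
          (cur_var ::= Sub (Read owner_arr (var arg_var)) (Const 1))
          (cur_var ::= var nxt_var;; nxt_var ::= Add (var nxt_var) (Const 1));;
        Write owner_arr (var arg_var) (Add (var i_var) (Const 1));;
        Write price_arr (var arg_var) (Add (Read price_arr (var arg_var)) (Const 1)))
       Skip"

lemma writes_bid_prog [simp]: "writes bid_prog =
    {a_var, b_var, c_var, d_var, cost_var, j_var, w_var, t_var, best_var, arg_var,
     i_var, cur_var, nxt_var, owner_arr, price_arr}"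
  by (auto simp: bid_prog_def)

text \<open>The arrays are reset because the auction is rerun for each score. Scaled costs are at
  most \<open>K = big * (N + 1)\<close>, and the number of rounds is one more than the bound
  \<open>N * (K + 1)\<close> on the bids made while it runs.\<close>

definition auction_prog :: prog where
  "auction_prog =
     (for_loop j_var (var N_var)
       (Write price_arr (var j_var) (Const 0);; Write owner_arr (var j_var) (Const 0));;
     cur_var ::= Const 0;;
     nxt_var ::= Const 1;;
     mul w_var t_var (var big_var) (Add (var N_var) (Const 1));;
     mul rounds_var t_var (var N_var) (Add (var w_var) (Const 1));;
     for_loop r_var (Add (var rounds_var) (Const 1)) bid_prog)"

lemma writes_auction_prog [simp]: "writes auction_prog =
    {a_var, b_var, c_var, d_var, cost_var, j_var, w_var, t_var, best_var, arg_var,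
     i_var, cur_var, nxt_var, owner_arr, price_arr, rounds_var, r_var}"
  by (auto simp: auction_prog_def)

definition total_prog :: prog where
  "total_prog =
     (total_var ::= Const 0;;
      for_loop j_var (var N_var)
        (i_var ::= Sub (Read owner_arr (var j_var)) (Const 1);;
         cost_prog;;
         total_var ::= Add (var total_var) (var cost_var)))"

lemma writes_total_prog [simp]: "writes total_prog =
    {a_var, b_var, c_var, d_var, cost_var, j_var, i_var, total_var}"
  by (auto simp: total_prog_def)

section \<open>Correctness of the auction programs\<close>

lemma loop_bound:
  fixes N b M :: nat
  assumes "0 < N" "N * (b * (N + 1) + 1) + 2 \<le> M"
  shows "N \<le> M" "b \<le> M"
  using assms by (cases N; auto simp: algebra_simps)+

text \<open>The loop over the bids is the longest, so a bound for it covers the other loops. With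
  \<open>m \<le> big\<close>, allowed pairs also cost at most \<open>big\<close>, which bounds all
  prices.\<close>

locale auction_run = assignment_reduction V m k s p big
  for V m k s p big +
  fixes M :: nat
  assumes bound: "N * (big * (N + 1) + 1) + 2 \<le> M" and m_big: "m \<le> big" and n_pos: "0 < n"
begin

lemma N_pos: "0 < N"
  using m_pos s by simp

lemma bounds: "N \<le> M" "big \<le> M" "N * (big * (N + 1) + 1) + 1 \<le> M"
  using loop_bound[OF N_pos bound] bound by auto

lemma cost_le_big: "cost i j \<le> big"
proof -
  have "i mod m < m" using m_pos by simp
  then have "i mod m - k \<le> big" "k - i mod m \<le> big" using m_big k by linarith+
  then show ?thesis by (simp add: cost_def)
qed

definition globals :: "store \<Rightarrow> bool" where
  "globals \<sigma> \<longleftrightarrow> \<sigma> 0 0 = m \<and> \<sigma> 0 2 = k \<and> \<sigma> 0 3 = p \<and> (\<forall>i<n * m. \<sigma> 0 (i + 5) = cand i) \<and>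
     \<sigma> 1 0 = n * m + 5 \<and> \<sigma> u_var 0 = u \<and> \<sigma> s_var 0 = s \<and> \<sigma> N_var 0 = N \<and> \<sigma> big_var 0 = big"

text \<open>The input and the parameters of a round occupy the arrays numbered below 6, and the
  auction and the final summation write only arrays with larger numbers.\<close>

lemma globals_cong: "globals \<sigma> \<Longrightarrow> (\<And>x. x < 6 \<Longrightarrow> \<tau> x = \<sigma> x) \<Longrightarrow> globals \<tau>"
  by (simp add: globals_def)

lemma wp_cost_prog:
  assumes G: "globals \<sigma>" and ij: "\<sigma> i_var 0 = i" "\<sigma> j_var 0 = j" "i < N" "j < N"
    and Q: "\<And>\<tau>. (\<And>x. x \<notin> {a_var, b_var, c_var, d_var, cost_var} \<Longrightarrow> \<tau> x = \<sigma> x) \<Longrightarrow> \<tau> cost_var 0 = cost i j \<Longrightarrow> Q \<tau>"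
  shows "wp M cost_prog Q \<sigma>"
proof -
  have M: "i \<le> M" "j \<le> M" "j - u \<le> M" using ij bounds by auto
  have [simp]: "\<sigma> i_var 0 = i" "\<sigma> j_var 0 = j" "\<sigma> 0 0 = m" "\<sigma> 0 2 = k" "\<sigma> 0 3 = p" "\<sigma> (Suc 0) 0 = n * m + 5"
    "\<sigma> u_var 0 = u" "\<sigma> s_var 0 = s" "\<sigma> big_var 0 = big"
    and cand: "\<And>i. i < n * m \<Longrightarrow> \<sigma> 0 (i + 5) = cand i"
    using G ij by (simp_all add: globals_def)
  have "wp M cost_prog (\<lambda>\<tau>. \<tau> cost_var 0 = cost i j) \<sigma>"
    unfolding cost_prog_def
    by (intro wp_If wp_Seq wp_divmod wp_Write)
      (simp_all add: cost_def M s k m_pos cand)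
  then show ?thesis
    by (rule wp_frame) (use Q in auto)
qed

lemma wp_best_prog:
  assumes G: "globals \<sigma>" and i: "\<sigma> i_var 0 = i" "i < N"
    and Q: "\<And>\<tau> a. (\<And>x. x \<notin> writes best_prog \<Longrightarrow> \<tau> x = \<sigma> x) \<Longrightarrow> \<tau> arg_var 0 = a \<Longrightarrow> a < N \<Longrightarrow>
      (\<And>j. j < N \<Longrightarrow> cost i a * (N + 1) + \<sigma> price_arr a \<le> cost i j * (N + 1) + \<sigma> price_arr j) \<Longrightarrow> Q \<tau>"
  shows "wp M best_prog Q \<sigma>"
proof -
  define w where "w j = cost i j * (N + 1) + \<sigma> price_arr j" for j
  \<comment> \<open>Nothing is claimed for \<open>j = 0\<close>: \<open>best_var\<close> may hold a
    value of an earlier scan, and the first object is accepted unconditionally.\<close>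
  define I where "I j \<tau> \<longleftrightarrow> (0 < j \<longrightarrow> \<tau> arg_var 0 < j \<and> \<tau> best_var 0 = w (\<tau> arg_var 0) \<and>
    (\<forall>j'<j. \<tau> best_var 0 \<le> w j'))" for j :: nat and \<tau> :: store
  have "wp M best_prog (I N) \<sigma>"
    unfolding best_prog_def
  proof (rule wp_for_loop[where I = I])
    show "expr_value (var N_var) \<sigma> = N" using G by (simp add: globals_def)
    show "N \<le> M" by (rule bounds)
    show "I 0 (put j_var 0 0 \<sigma>)" by (simp add: I_def)
  next
    fix j \<tau>
    assume j: "j < N" and I: "I j \<tau>" and \<tau>j: "\<tau> j_var 0 = j"
      and frame: "\<And>y. y \<notin> insert j_var (writes
         (cost_prog;;
          mul w_var t_var (var cost_var) (Add (var N_var) (Const 1));;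
          w_var ::= Add (var w_var) (Read price_arr (var j_var));;
          If (Add (Sub (Const 1) (var j_var)) (Sub (var best_var) (var w_var)))
            (best_var ::= var w_var;; arg_var ::= var j_var) Skip)) \<Longrightarrow> \<tau> y = \<sigma> y"
    have G\<tau>: "globals \<tau>" using frame by (intro globals_cong[OF G]) simp
    have price: "\<tau> price_arr = \<sigma> price_arr" and i\<tau>: "\<tau> i_var 0 = i"
      using frame i by simp_all
    show "wp M (cost_prog;;
        mul w_var t_var (var cost_var) (Add (var N_var) (Const 1));;
        w_var ::= Add (var w_var) (Read price_arr (var j_var));;
        If (Add (Sub (Const 1) (var j_var)) (Sub (var best_var) (var w_var)))
          (best_var ::= var w_var;; arg_var ::= var j_var) Skip)
      (\<lambda>\<tau>'. I (Suc j) (put j_var 0 (Suc j) \<tau>')) \<tau>"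
    proof (rule wp_Seq, rule wp_cost_prog[OF G\<tau> i\<tau> \<tau>j i(2) j])
      fix \<tau>'
      assume frame': "\<And>x. x \<notin> {a_var, b_var, c_var, d_var, cost_var} \<Longrightarrow> \<tau>' x = \<tau> x"
        and c: "\<tau>' cost_var 0 = cost i j"
      have [simp]: "\<tau>' N_var 0 = N" "\<tau>' j_var 0 = j" "\<tau>' price_arr = \<sigma> price_arr"
        "\<tau>' best_var = \<tau> best_var" "\<tau>' arg_var = \<tau> arg_var"
        using frame' G\<tau> \<tau>j price by (auto simp: globals_def)
      have "cost i j \<le> M" using cost_le_big bounds le_trans by blast
      then show "wp M (mul w_var t_var (var cost_var) (Add (var N_var) (Const 1));;
        w_var ::= Add (var w_var) (Read price_arr (var j_var));;
        If (Add (Sub (Const 1) (var j_var)) (Sub (var best_var) (var w_var)))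
          (best_var ::= var w_var;; arg_var ::= var j_var) Skip)
        (\<lambda>\<tau>'. I (Suc j) (put j_var 0 (Suc j) \<tau>')) \<tau>'"
        using I by (intro wp_Seq wp_mul wp_Write wp_If wp_Skip)
          (auto simp: I_def c w_def less_Suc_eq le_Suc_eq split: if_splits)
    qed
  qed auto
  then show ?thesis
  proof (rule wp_frame)
    fix \<tau> assume "I N \<tau>" "\<And>x. x \<notin> writes best_prog \<Longrightarrow> \<tau> x = \<sigma> x"
    then show "Q \<tau>" using N_pos by (intro Q[of \<tau> "\<tau> arg_var 0"]) (auto simp: I_def w_def)
  qed
qed

definition running :: "nat \<Rightarrow> store \<Rightarrow> bool" where
  "running r \<sigma> \<longleftrightarrow> auction_state (\<lambda>i j. cost i j * (N + 1)) N (big * (N + 1)) r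
     (\<sigma> price_arr) (\<sigma> owner_arr) (\<sigma> cur_var 0) (\<sigma> nxt_var 0)"

lemma wp_bid_prog:
  assumes G: "globals \<sigma>" and run: "running r \<sigma>"
  shows "wp M bid_prog (running (Suc r)) \<sigma>"
  unfolding bid_prog_def
proof (rule wp_If)
  assume "expr_value (Sub (var N_var) (var cur_var)) \<sigma> = 0"
  then have "\<not> \<sigma> cur_var 0 < N" using G by (simp add: globals_def)
  from auction_state_idle[OF run[unfolded running_def] this] have idle: "running (Suc r) \<sigma>"
    unfolding running_def .
  show "wp M Skip (running (Suc r)) \<sigma>" by (rule wp_Skip) (rule idle)
next
  assume "expr_value (Sub (var N_var) (var cur_var)) \<sigma> \<noteq> 0"
  then have cur: "\<sigma> cur_var 0 < N" using G by (simp add: globals_def)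
  let ?\<sigma> = "put i_var 0 (\<sigma> cur_var 0) \<sigma>"
  let ?update = "If (Read owner_arr (var arg_var))
      (cur_var ::= Sub (Read owner_arr (var arg_var)) (Const 1))
      (cur_var ::= var nxt_var;; nxt_var ::= Add (var nxt_var) (Const 1));;
    Write owner_arr (var arg_var) (Add (var i_var) (Const 1));;
    Write price_arr (var arg_var) (Add (Read price_arr (var arg_var)) (Const 1))"
  have rest: "wp M (best_prog;; ?update) (running (Suc r)) ?\<sigma>"
  proof (rule wp_Seq, rule wp_best_prog[OF _ _ cur])
    show "globals ?\<sigma>" by (rule globals_cong[OF G]) simp
    show "?\<sigma> i_var 0 = \<sigma> cur_var 0" by simp
  next
    fix \<tau> a
    assume frame: "\<And>x. x \<notin> writes best_prog \<Longrightarrow> \<tau> x = ?\<sigma> x" and a: "\<tau> arg_var 0 = a" "a < N"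
      and best: "\<And>j. j < N \<Longrightarrow> cost (\<sigma> cur_var 0) a * (N + 1) + ?\<sigma> price_arr a
        \<le> cost (\<sigma> cur_var 0) j * (N + 1) + ?\<sigma> price_arr j"
    have [simp]: "\<tau> price_arr = \<sigma> price_arr" "\<tau> owner_arr = \<sigma> owner_arr" "\<tau> cur_var = \<sigma> cur_var"
      "\<tau> nxt_var = \<sigma> nxt_var" "\<tau> i_var 0 = \<sigma> cur_var 0"
      using frame by auto
    have *: "auction_state (\<lambda>i j. cost i j * (N + 1)) N (big * (N + 1)) (Suc r)
        ((\<sigma> price_arr)(a := Suc (\<sigma> price_arr a))) ((\<sigma> owner_arr)(a := Suc (\<sigma> cur_var 0)))
        (if \<sigma> owner_arr a = 0 then \<sigma> nxt_var 0 else \<sigma> owner_arr a - 1)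
        (if \<sigma> owner_arr a = 0 then Suc (\<sigma> nxt_var 0) else \<sigma> nxt_var 0)"
    proof (rule auction_state_step[OF run[unfolded running_def] cur a(2)])
      show "cost i j * (N + 1) \<le> big * (N + 1)" for i j
        by (rule mult_le_mono1[OF cost_le_big])
      show "cost (\<sigma> cur_var 0) a * (N + 1) + \<sigma> price_arr a \<le> cost (\<sigma> cur_var 0) j * (N + 1) + \<sigma> price_arr j"
        if "j < N" for j
        using best[OF that] by simp
    qed
    show "wp M ?update (running (Suc r)) \<tau>"
      using a * by (intro wp_Seq wp_If wp_Write) (auto simp: running_def fun_upd_def)
  qed
  show "wp M (i_var ::= var cur_var;; best_prog;; ?update) (running (Suc r)) \<sigma>"
    by (rule wp_Seq, rule wp_Write) (use rest in simp)
qed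

lemma wp_auction_prog:
  assumes G: "globals \<sigma>"
    and Q: "\<And>\<tau>. (\<And>x. x \<notin> writes auction_prog \<Longrightarrow> \<tau> x = \<sigma> x) \<Longrightarrow>
      running (N * (big * (N + 1) + 1) + 1) \<tau> \<Longrightarrow> Q \<tau>"
  shows "wp M auction_prog Q \<sigma>"
proof -
  have "wp M auction_prog (running (N * (big * (N + 1) + 1) + 1)) \<sigma>"
    unfolding auction_prog_def
  proof (rule wp_Seq, rule wp_for_loop[where I = "\<lambda>j \<tau>. \<forall>i<j. \<tau> price_arr i = 0 \<and> \<tau> owner_arr i = 0"])
    show "expr_value (var N_var) \<sigma> = N" using G by (simp add: globals_def)
    show "N \<le> M" by (rule bounds)
  next
    fix j :: nat and \<tau> :: store
    assume "\<forall>i<j. \<tau> price_arr i = 0 \<and> \<tau> owner_arr i = 0" "\<tau> j_var 0 = j"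
    then show "wp M (Write price_arr (var j_var) (Const 0);; Write owner_arr (var j_var) (Const 0))
        (\<lambda>\<tau>'. \<forall>i<Suc j. put j_var 0 (Suc j) \<tau>' price_arr i = 0 \<and> put j_var 0 (Suc j) \<tau>' owner_arr i = 0) \<tau>"
      by (intro wp_Seq wp_Write) auto
  next
    fix \<tau> assume init: "\<forall>i<N. \<tau> price_arr i = 0 \<and> \<tau> owner_arr i = 0"
      and frame: "\<And>y. y \<notin> insert j_var (writes (Write price_arr (var j_var) (Const 0);;
        Write owner_arr (var j_var) (Const 0))) \<Longrightarrow> \<tau> y = \<sigma> y"
    have [simp]: "\<tau> N_var 0 = N" "\<tau> big_var 0 = big"
      using frame G by (auto simp: globals_def)
    let ?w = "big * (N + 1)"
    let ?\<tau> = "put rounds_var 0 (N * (?w + 1)) (put t_var 0 N (put w_var 0 ?w (put t_var 0 big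
      (put nxt_var 0 1 (put cur_var 0 0 \<tau>)))))"
    have "wp M (for_loop r_var (Add (var rounds_var) (Const 1)) bid_prog) (running (N * (?w + 1) + 1)) ?\<tau>"
    proof (rule wp_for_loop[where I = running])
      show "expr_value (Add (var rounds_var) (Const 1)) ?\<tau> = N * (?w + 1) + 1" by simp
      show "N * (?w + 1) + 1 \<le> M" by (rule bounds)
      show "running 0 (put r_var 0 0 ?\<tau>)"
        using auction_state_init[of N "\<tau> price_arr" "\<tau> owner_arr"] init N_pos by (simp add: running_def)
    next
      fix r \<upsilon> assume run: "running r \<upsilon>"
        and frame': "\<And>y. y \<notin> insert r_var (writes bid_prog) \<Longrightarrow> \<upsilon> y = ?\<tau> y"
      have "globals \<upsilon>"
        using frame frame' by (intro globals_cong[OF G]) auto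
      from wp_bid_prog[OF this run]
      show "wp M bid_prog (\<lambda>\<upsilon>'. running (Suc r) (put r_var 0 (Suc r) \<upsilon>')) \<upsilon>"
        by (rule wp_mono) (simp add: running_def)
    qed auto
    then show "wp M (cur_var ::= Const 0;; nxt_var ::= Const 1;;
        mul w_var t_var (var big_var) (Add (var N_var) (Const 1));;
        mul rounds_var t_var (var N_var) (Add (var w_var) (Const 1));;
        for_loop r_var (Add (var rounds_var) (Const 1)) bid_prog) (running (N * (?w + 1) + 1)) \<tau>"
      using bounds by (intro wp_Seq wp_Write wp_mul) simp_all
  qed auto
  then show ?thesis by (rule wp_frame) (use Q in blast)
qed

text \<open>The optimum is described by its comparison with every threshold \<open>b\<close>, the
  form in which the reduction uses it.\<close>

lemma wp_total_prog:
  assumes G: "globals \<sigma>" and run: "running (N * (big * (N + 1) + 1) + 1) \<sigma>"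
    and Q: "\<And>\<tau>. (\<And>x. x \<notin> writes total_prog \<Longrightarrow> \<tau> x = \<sigma> x) \<Longrightarrow>
      (\<And>b. \<tau> total_var 0 \<le> b \<longleftrightarrow>
        (\<exists>g. bij_betw g {..<N} {..<N} \<and> (\<Sum>i<N. cost i (g i)) \<le> b)) \<Longrightarrow> Q \<tau>"
  shows "wp M total_prog Q \<sigma>"
proof -
  have fin: "\<not> \<sigma> cur_var 0 < N"
    by (rule auction_state_finished[OF run[unfolded running_def]]) simp
  have "wp M total_prog (\<lambda>\<tau>. \<tau> total_var 0 = (\<Sum>j<N. cost (\<sigma> owner_arr j - 1) j)) \<sigma>"
    unfolding total_prog_def
  proof (rule wp_Seq, rule wp_Write,
      rule wp_for_loop[where I = "\<lambda>l \<tau>. \<tau> total_var 0 = (\<Sum>j<l. cost (\<sigma> owner_arr j - 1) j)"])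
    show "expr_value (var N_var) (put total_var (expr_value (Const 0) \<sigma>) (expr_value (Const 0) \<sigma>) \<sigma>) = N"
      using G by (simp add: globals_def)
    show "N \<le> M" by (rule bounds)
  next
    fix j \<tau>
    let ?body = "i_var ::= Sub (Read owner_arr (var j_var)) (Const 1);; cost_prog;;
      total_var ::= Add (var total_var) (var cost_var)"
    assume j: "j < N" "\<tau> j_var 0 = j" and total: "\<tau> total_var 0 = (\<Sum>j<j. cost (\<sigma> owner_arr j - 1) j)"
      and frame: "\<And>y. y \<notin> insert j_var (writes ?body) \<Longrightarrow>
        \<tau> y = put total_var (expr_value (Const 0) \<sigma>) (expr_value (Const 0) \<sigma>) \<sigma> y"
    have [simp]: "\<tau> owner_arr = \<sigma> owner_arr" using frame by simp
    let ?\<tau> = "put i_var 0 (\<sigma> owner_arr j - 1) \<tau>"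
    have G\<tau>: "globals ?\<tau>" using frame by (intro globals_cong[OF G]) simp
    have body: "wp M (cost_prog;; total_var ::= Add (var total_var) (var cost_var))
      (\<lambda>\<tau>'. put j_var 0 (Suc j) \<tau>' total_var 0 = (\<Sum>j<Suc j. cost (\<sigma> owner_arr j - 1) j)) ?\<tau>"
    proof (rule wp_Seq, rule wp_cost_prog[OF G\<tau>])
      show "\<sigma> owner_arr j - 1 < N" by (rule auction_state_owner_less[OF run[unfolded running_def] fin j(1)])
      fix \<tau>'
      assume "\<And>x. x \<notin> {a_var, b_var, c_var, d_var, cost_var} \<Longrightarrow> \<tau>' x = ?\<tau> x"
        and "\<tau>' cost_var 0 = cost (\<sigma> owner_arr j - 1) j"
      then show "wp M (total_var ::= Add (var total_var) (var cost_var))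
        (\<lambda>\<tau>'. put j_var 0 (Suc j) \<tau>' total_var 0 = (\<Sum>j<Suc j. cost (\<sigma> owner_arr j - 1) j)) \<tau>'"
        using total by (intro wp_Write) simp
    qed (use j in simp_all)
    show "wp M ?body
      (\<lambda>\<tau>'. put j_var 0 (Suc j) \<tau>' total_var 0 = (\<Sum>j<Suc j. cost (\<sigma> owner_arr j - 1) j)) \<tau>"
      by (rule wp_Seq, rule wp_Write) (use body j in simp)
  qed auto
  then show ?thesis
  proof (rule wp_frame)
    fix \<tau> assume "\<tau> total_var 0 = (\<Sum>j<N. cost (\<sigma> owner_arr j - 1) j)"
      "\<And>x. x \<notin> writes total_prog \<Longrightarrow> \<tau> x = \<sigma> x"
    then show "Q \<tau>" using auction_state_optimal[OF run[unfolded running_def] fin] by (intro Q) auto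
  qed
qed

end

text \<open>Scores start at 1, hence \<open>q + 1\<close>. A score with more persons than objects is
  skipped: \<open>n * m > N\<close> means \<open>n * k > m * s\<close>, too many approvals for
  \<open>m\<close> candidates with at most \<open>s\<close> each.\<close>

definition round_prog :: prog where
  "round_prog =
     (s_var ::= Add (var q_var) (Const 1);;
      mul N_var t_var num_expr (var s_var);;
      N_var ::= Add (var N_var) (var u_var);;
      If (Sub persons_expr (var N_var)) Skip
        (auction_prog;;
         total_prog;;
         If (Sub (var total_var) (var limit_var)) Skip (answer_var ::= Const 1)))"

lemma writes_round_prog [simp]: "writes round_prog =
    {a_var, b_var, c_var, d_var, cost_var, j_var, w_var, t_var, best_var, arg_var,
     i_var, cur_var, nxt_var, owner_arr, price_arr, rounds_var, r_var, total_var,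
     s_var, N_var, answer_var}"
  by (auto simp: round_prog_def)

text \<open>
  \<open>limit_var\<close> becomes \<open>min \<beta> (n * m * m)\<close>, where no choice of approval sets costs more than
  \<open>n * m * m\<close>. An assignment of cost at most this limit therefore avoids the pairs of cost
  \<open>n * m * m + 1\<close>, and the value of \<open>\<beta>\<close> does not affect the running time.
\<close>

definition search_prog :: prog where
  "search_prog =
     (mul u_var t_var votes_expr (Sub num_expr k_expr);;
      mul big_var t_var persons_expr num_expr;;
      limit_var ::= Sub budget_expr (Sub budget_expr (var big_var));;
      big_var ::= Add (var big_var) (Const 1);;
      answer_var ::= Const 0;;
      for_loop q_var votes_expr round_prog)"

text \<open>The tests ask for \<open>k < m\<close>, \<open>0 < k\<close> and
  \<open>0 < n * m\<close>. As the preferred candidate exists, \<open>m\<close> is positive and the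
  last test detects an empty list of votes.\<close>

definition bribery_prog :: prog where
  "bribery_prog =
     (If (Sub num_expr k_expr)
        (If k_expr
          (If persons_expr search_prog (answer_var ::= Const 1))
          (answer_var ::= Const 1))
        (answer_var ::= Const 1);;
      0 ::= var answer_var)"

section \<open>Search over the winning score\<close>

locale bribery_run =
  fixes V :: "nat vote list" and m k p \<beta> M :: nat
  assumes votes: "\<And>v. v < length V \<Longrightarrow> set (V ! v) = {..<m} \<and> distinct (V ! v)"
    and k: "0 < k" "k < m" and p: "p < m" and V: "V \<noteq> []"
    and bound: "\<And>s. s \<le> length V \<Longrightarrow>
      (length V * (m - k) + m * s) * ((length V * m * m + 1) * (length V * (m - k) + m * s + 1) + 1) + 2 \<le> M"
begin

abbreviation "nv \<equiv> length V"

text \<open>An exact score for \<open>p\<close>, not a lower bound, is what the completely filled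
  block of \<open>p\<close> expresses. Quantifying over \<open>s\<close> recovers the winning
  condition.\<close>

definition approvable :: "nat \<Rightarrow> bool" where
  "approvable s \<longleftrightarrow> (\<exists>S. (\<forall>v<nv. S v \<subseteq> {..<m} \<and> card (S v) = k) \<and>
      (\<forall>d<m. card {v. v < nv \<and> d \<in> S v} \<le> s) \<and> card {v. v < nv \<and> p \<in> S v} = s \<and>
      (\<Sum>v<nv. exchange_cost k (S v) (V ! v)) \<le> \<beta>)"

lemma n_pos: "0 < nv"
  using V by simp

lemma exchange_cost_total_le: "(\<Sum>v<nv. exchange_cost k (S v) (V ! v)) \<le> nv * m * m"
proof -
  have "exchange_cost k (S v) (V ! v) \<le> m * m" if v: "v < nv" for v
  proof -
    have len: "length (V ! v) = m" using votes[OF v] distinct_card[of "V ! v"] by simp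
    have "exchange_cost k (S v) (V ! v) = (\<Sum>r<m. if V ! v ! r \<in> S v then r - k else k - r)"
      using exchange_cost_nth[of "V ! v" k "S v"] votes[OF v] len by simp
    also have "\<dots> \<le> (\<Sum>r<m. m)"
      using k by (intro sum_mono) auto
    finally show ?thesis by simp
  qed
  then have "(\<Sum>v<nv. exchange_cost k (S v) (V ! v)) \<le> (\<Sum>v<nv. m * m)"
    by (intro sum_mono) auto
  then show ?thesis by simp
qed

lemma approvable_limit:
  "approvable s \<longleftrightarrow> (\<exists>S. (\<forall>v<nv. S v \<subseteq> {..<m} \<and> card (S v) = k) \<and>
      (\<forall>d<m. card {v. v < nv \<and> d \<in> S v} \<le> s) \<and> card {v. v < nv \<and> p \<in> S v} = s \<and>
      (\<Sum>v<nv. exchange_cost k (S v) (V ! v)) \<le> \<beta> - (\<beta> - nv * m * m))"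
proof -
  have "(\<Sum>v<nv. exchange_cost k (S v) (V ! v)) \<le> \<beta> - (\<beta> - nv * m * m) \<longleftrightarrow>
    (\<Sum>v<nv. exchange_cost k (S v) (V ! v)) \<le> \<beta>" for S
    using exchange_cost_total_le[of S] by linarith
  then show ?thesis unfolding approvable_def by simp
qed

lemma count_approvals:
  assumes "\<And>v. v < nv \<Longrightarrow> S v \<subseteq> {..<m} \<and> card (S v) = k"
  shows "(\<Sum>d<m. card {v. v < nv \<and> d \<in> S v}) = nv * k"
proof -
  have "(\<Sum>d<m. card {v. v < nv \<and> d \<in> S v}) = (\<Sum>d<m. \<Sum>v<nv. if d \<in> S v then 1 else 0)"
  proof (intro sum.cong refl)
    fix d
    have "{..<nv} \<inter> {v. d \<in> S v} = {v. v < nv \<and> d \<in> S v}" by auto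
    then show "card {v. v < nv \<and> d \<in> S v} = (\<Sum>v<nv. if d \<in> S v then 1 else 0)"
      by (simp add: sum.If_cases)
  qed
  also have "\<dots> = (\<Sum>v<nv. \<Sum>d<m. if d \<in> S v then 1 else 0)"
    by (rule sum.swap)
  also have "\<dots> = (\<Sum>v<nv. k)"
  proof (intro sum.cong refl)
    fix v assume "v \<in> {..<nv}"
    then have "{..<m} \<inter> S v = S v" "card (S v) = k" using assms by auto
    then show "(\<Sum>d<m. if d \<in> S v then 1 else 0) = k" by (simp add: sum.If_cases)
  qed
  finally show ?thesis by simp
qed

text \<open>The votes give \<open>n * k\<close> approvals in total, and each of the \<open>m\<close>
  candidates gets at most \<open>s\<close> of them. This makes the skipping of rounds sound and the
  search through \<open>1, ..., n\<close> complete.\<close>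

lemma approvable_room:
  assumes "approvable s"
  shows "nv * m \<le> nv * (m - k) + m * s" "0 < s" "s \<le> nv"
proof -
  obtain S where S: "\<And>v. v < nv \<Longrightarrow> S v \<subseteq> {..<m} \<and> card (S v) = k"
    and score: "\<And>d. d < m \<Longrightarrow> card {v. v < nv \<and> d \<in> S v} \<le> s" "card {v. v < nv \<and> p \<in> S v} = s"
    using assms by (auto simp: approvable_def)
  have "nv * k \<le> (\<Sum>d<m. s)"
    using count_approvals[of S] S sum_mono[of "{..<m}" "\<lambda>d. card {v. v < nv \<and> d \<in> S v}" "\<lambda>_. s"] score(1)
    by simp
  then have nk: "nv * k \<le> m * s" by simp
  moreover have "nv * m = nv * (m - k) + nv * k"
    using k by (simp flip: distrib_left)
  ultimately show "nv * m \<le> nv * (m - k) + m * s" by simp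
  show "0 < s" using nk n_pos k by (cases s) auto
  show "s \<le> nv" using score(2) card_mono[of "{..<nv}" "{v. v < nv \<and> p \<in> S v}"] by auto
qed

lemma swap_bribery_iff_approvable:
  assumes "election {..<m} V"
  shows "swap_bribery (k_approval k) {..<m} V p (\<lambda>_. 1) \<beta> \<longleftrightarrow> (\<exists>s. 0 < s \<and> s \<le> nv \<and> approvable s)"
proof -
  have "swap_bribery (k_approval k) {..<m} V p (\<lambda>_. 1) \<beta> \<longleftrightarrow> (\<exists>s. approvable s)"
    (is "?L \<longleftrightarrow> ?R")
  proof -
    have "?L \<longleftrightarrow> (\<exists>S. (\<forall>v<nv. S v \<subseteq> {..<m} \<and> card (S v) = k) \<and>
        (\<forall>d\<in>{..<m}. card {v. v < nv \<and> d \<in> S v} \<le> card {v. v < nv \<and> p \<in> S v}) \<and>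
        (\<Sum>v<nv. exchange_cost k (S v) (V ! v)) \<le> \<beta>)"
      using p k by (intro swap_bribery_iff_approval_sets[OF assms]) auto
    also have "\<dots> \<longleftrightarrow> ?R"
      unfolding approvable_def Ball_def lessThan_iff by blast
    finally show ?thesis .
  qed
  then show ?thesis using approvable_room by blast
qed

definition input_store :: "store \<Rightarrow> bool" where
  "input_store \<sigma> \<longleftrightarrow> \<sigma> 0 0 = m \<and> \<sigma> 0 1 = nv \<and> \<sigma> 0 2 = k \<and> \<sigma> 0 3 = p \<and> \<sigma> 0 4 = \<beta> \<and>
     (\<forall>i<nv * m. \<sigma> 0 (i + 5) = V ! (i div m) ! (i mod m)) \<and> \<sigma> (Suc 0) 0 = nv * m + 5"

lemma input_store_cong: "input_store \<sigma> \<Longrightarrow> \<tau> 0 = \<sigma> 0 \<Longrightarrow> \<tau> (Suc 0) = \<sigma> (Suc 0) \<Longrightarrow> input_store \<tau>"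
  by (simp add: input_store_def)

lemma nm_le: "nv * m \<le> M" "nv \<le> M" "m \<le> M"
proof -
  have "nv * m * m + 1 \<le> M"
    using loop_bound(2)[OF _ bound[OF order_refl]] k n_pos by simp
  moreover have "nv * m * 1 \<le> nv * m * m" "nv * 1 \<le> nv * m" "1 * m \<le> nv * m"
    using k n_pos by (simp_all only: mult_le_mono1 mult_le_mono2 Suc_le_eq One_nat_def)
  ultimately show "nv * m \<le> M" "nv \<le> M" "m \<le> M" by linarith+
qed

lemma wp_round_prog:
  assumes inp: "input_store \<sigma>" and i: "i < nv" "\<sigma> q_var 0 = i"
    and glob: "\<sigma> u_var 0 = nv * (m - k)" "\<sigma> big_var 0 = nv * m * m + 1" "\<sigma> limit_var 0 = \<beta> - (\<beta> - nv * m * m)"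
  shows "wp M round_prog (\<lambda>\<tau>. \<tau> answer_var 0 = (if approvable (Suc i) then 1 else \<sigma> answer_var 0)) \<sigma>"
proof -
  let ?s = "Suc i" and ?big = "nv * m * m + 1"
  let ?N = "nv * (m - k) + m * ?s"
  let ?R = "\<lambda>\<tau>. \<tau> answer_var 0 = (if approvable ?s then 1 else \<sigma> answer_var 0)"
  let ?\<sigma> = "put N_var 0 ?N (put N_var 0 (m * ?s) (put t_var 0 m (put s_var 0 ?s \<sigma>)))"
  have "wp M (If (Sub persons_expr (var N_var)) Skip
        (auction_prog;; total_prog;; If (Sub (var total_var) (var limit_var)) Skip (answer_var ::= Const 1))) ?R ?\<sigma>"
  proof (rule wp_If)
    assume "expr_value (Sub persons_expr (var N_var)) ?\<sigma> \<noteq> 0"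
    then have "\<not> approvable ?s"
      using approvable_room(1)[of ?s] inp by (auto simp: input_store_def)
    then show "wp M Skip ?R ?\<sigma>" by (intro wp_Skip) simp
  next
    assume "expr_value (Sub persons_expr (var N_var)) ?\<sigma> = 0"
    then have room: "nv * m \<le> ?N" using inp by (simp add: input_store_def)
    have "1 * m \<le> nv * m * m" using n_pos k by (intro mult_le_mono1) (simp add: Suc_le_eq)
    then have "m \<le> ?big" by linarith
    then interpret auction_run V m k ?s p ?big M
      using votes k p room bound[of ?s] i(1) n_pos by unfold_locales auto
    have G: "globals ?\<sigma>"
      unfolding globals_def using inp glob by (simp add: input_store_def cand_def)
    show "wp M (auction_prog;; total_prog;; If (Sub (var total_var) (var limit_var)) Skip (answer_var ::= Const 1)) ?R ?\<sigma>"
    proof (rule wp_Seq, rule wp_auction_prog[OF G])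
      fix \<tau> assume frame: "\<And>x. x \<notin> writes auction_prog \<Longrightarrow> \<tau> x = ?\<sigma> x"
        and run: "running (?N * (?big * (?N + 1) + 1) + 1) \<tau>"
      have G\<tau>: "globals \<tau>" using frame by (intro globals_cong[OF G]) simp
      show "wp M (total_prog;; If (Sub (var total_var) (var limit_var)) Skip (answer_var ::= Const 1)) ?R \<tau>"
      proof (rule wp_Seq, rule wp_total_prog[OF G\<tau> run])
        fix \<upsilon> assume frame': "\<And>x. x \<notin> writes total_prog \<Longrightarrow> \<upsilon> x = \<tau> x"
          and opt: "\<And>b. \<upsilon> total_var 0 \<le> b \<longleftrightarrow>
            (\<exists>g. bij_betw g {..<?N} {..<?N} \<and> (\<Sum>i<?N. cost i (g i)) \<le> b)"
        define l where "l = \<beta> - (\<beta> - nv * m * m)"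
        have [simp]: "\<upsilon> limit_var 0 = l" "\<upsilon> answer_var 0 = \<sigma> answer_var 0"
          using frame frame' glob by (simp_all add: l_def)
        have "l < ?big" by (simp add: l_def)
        then have "\<upsilon> total_var 0 \<le> l \<longleftrightarrow> approvable ?s"
          unfolding opt approvable_limit l_def[symmetric] by (rule assignment_iff_approval_sets)
        then show "wp M (If (Sub (var total_var) (var limit_var)) Skip (answer_var ::= Const 1)) ?R \<upsilon>"
          by (intro wp_If wp_Skip wp_Write) simp_all
      qed
    qed
  qed
  then show ?thesis
    unfolding round_prog_def using nm_le inp i glob(1)
    by (intro wp_Seq wp_Write wp_mul) (simp_all add: input_store_def add.commute)
qed

lemma wp_search_prog:
  assumes inp: "input_store \<sigma>"
  shows "wp M search_prog (\<lambda>\<tau>. \<tau> answer_var 0 \<noteq> 0 \<longleftrightarrow> (\<exists>s. 0 < s \<and> s \<le> nv \<and> approvable s)) \<sigma>"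
proof -
  let ?R = "\<lambda>i \<tau>. \<tau> answer_var 0 \<noteq> 0 \<longleftrightarrow> (\<exists>s. 0 < s \<and> s \<le> i \<and> approvable s)"
  let ?\<sigma> = "put answer_var 0 0 (put big_var 0 (nv * m * m + 1) (put limit_var 0 (\<beta> - (\<beta> - nv * m * m))
    (put big_var 0 (nv * m * m) (put t_var 0 (nv * m) (put u_var 0 (nv * (m - k)) (put t_var 0 nv \<sigma>))))))"
  have "wp M (for_loop q_var votes_expr round_prog) (?R nv) ?\<sigma>"
  proof (rule wp_for_loop[where I = ?R])
    show "expr_value votes_expr ?\<sigma> = nv" using inp by (simp add: input_store_def)
    show "nv \<le> M" by (rule nm_le)
  next
    fix i \<tau> assume i: "i < nv" "\<tau> q_var 0 = i" and I: "?R i \<tau>"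
      and frame: "\<And>y. y \<notin> insert q_var (writes round_prog) \<Longrightarrow> \<tau> y = ?\<sigma> y"
    have "input_store \<tau>" using frame by (intro input_store_cong[OF inp]) simp_all
    then have "wp M round_prog (\<lambda>\<upsilon>. \<upsilon> answer_var 0 = (if approvable (Suc i) then 1 else \<tau> answer_var 0)) \<tau>"
      using frame i by (intro wp_round_prog) simp_all
    then show "wp M round_prog (\<lambda>\<upsilon>. ?R (Suc i) (put q_var 0 (Suc i) \<upsilon>)) \<tau>"
    proof (rule wp_mono)
      fix \<upsilon> :: store
      assume "\<upsilon> answer_var 0 = (if approvable (Suc i) then 1 else \<tau> answer_var 0)"
      then show "?R (Suc i) (put q_var 0 (Suc i) \<upsilon>)" using I by (auto simp: le_Suc_eq)
    qed
  qed auto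
  then show ?thesis
    unfolding search_prog_def using nm_le inp
    by (intro wp_Seq wp_Write wp_mul) (simp_all add: input_store_def)
qed

end

section \<open>Input format and the polynomial bound\<close>

lemma concat_equal_length:
  assumes "\<And>v. v \<in> set V \<Longrightarrow> length v = m"
  shows "length (concat V) = length V * m"
    and "i < length V * m \<Longrightarrow> concat V ! i = V ! (i div m) ! (i mod m)"
proof -
  show len: "length (concat V) = length V * m" using assms by (induction V) auto
  show "i < length V * m \<Longrightarrow> concat V ! i = V ! (i div m) ! (i mod m)" using assms
  proof (induction V arbitrary: i)
    case (Cons v V)
    have v: "length v = m" using Cons.prems by simp
    show ?case
    proof (cases "i < m")
      case False
      then have "0 < m" "i - m < length V * m" using Cons.prems by (auto intro: Nat.gr0I)
      then show ?thesis
        using Cons.IH[of "i - m"] Cons.prems False v by (simp add: nth_append le_div_geq le_mod_geq)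
    qed (simp add: nth_append v)
  qed simp
qed

text \<open>Every entry counts for at least one bit, even 0. The running time is bounded through the
  number of entries alone.\<close>

lemma length_le_input_size: "length xs \<le> input_size xs"
  by (induction xs) (auto simp: input_size_def)

text \<open>If \<open>n * m \<le> L\<close>, both parts of \<open>N\<close> are at most
  \<open>L\<close>, so \<open>N \<le> 2 * L\<close>; with at least one vote,
  \<open>m \<le> L\<close> and \<open>n * m * m \<le> L * L\<close>. These estimates are substituted
  into the bound of \<open>bribery_run\<close>.\<close>

definition iterations :: "nat \<Rightarrow> nat" where
  "iterations L = 2 * L * ((L * L + 1) * (2 * L + 1) + 1) + 2"

lemma iterations_poly: "poly ([:0, 2:] * (([:0, 1:] * [:0, 1:] + [:1:]) * [:1, 2:] + [:1:]) + [:2:]) L = iterations L"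
  by (simp add: iterations_def algebra_simps)

lemma wp_bribery_prog:
  assumes valid: "valid_instance I" and L: "length (encode_instance I) \<le> L"
  shows "wp (iterations L) bribery_prog (\<lambda>\<tau>. accepting \<tau> \<longleftrightarrow> k_approval_unit_swap_bribery I)
    (initial_store (encode_instance I))"
proof -
  let ?V = "votes I" and ?m = "num_cands I" and ?k = "approvals I" and ?p = "preferred I" and ?b = "budget I"
  let ?\<sigma> = "initial_store (encode_instance I)" and ?M = "iterations L"
  have el: "election {..<?m} ?V" and p: "?p < ?m"
    using valid by (auto simp: valid_instance_def candidates_def)
  have V: "set v = {..<?m} \<and> distinct v" if "v \<in> set ?V" for v
    using el that by (auto simp: election_def permutations_of_set_def)
  then have len: "length v = ?m" if "v \<in> set ?V" for v
    using that distinct_card[of v] by simp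
  note concat = concat_equal_length[OF len]
  have nm: "length ?V * ?m \<le> L"
    using L by (simp add: encode_instance_def concat(1))
  have \<sigma>: "?\<sigma> 0 0 = ?m" "?\<sigma> 0 1 = length ?V" "?\<sigma> 0 2 = ?k" "?\<sigma> 0 3 = ?p" "?\<sigma> 0 4 = ?b"
    "?\<sigma> (Suc 0) 0 = length ?V * ?m + 5"
    "\<And>i. i < length ?V * ?m \<Longrightarrow> ?\<sigma> 0 (i + 5) = ?V ! (i div ?m) ! (i mod ?m)"
    by (simp_all add: initial_store_def encode_instance_def concat nth_append)
  let ?sol = "swap_bribery (k_approval ?k) {..<?m} ?V ?p (\<lambda>_. 1) ?b"
  let ?R = "\<lambda>\<tau>. \<tau> answer_var 0 \<noteq> 0 \<longleftrightarrow> ?sol"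
  have yes: "wp ?M (answer_var ::= Const 1) ?R ?\<sigma>" if "?k = 0 \<or> ?V = [] \<or> ?m \<le> ?k"
    using swap_bribery_trivial[OF el, of ?p ?k ?b] p that by (intro wp_Write) simp
  have search: "wp ?M search_prog ?R ?\<sigma>" if k: "0 < ?k" "?k < ?m" and ne: "?V \<noteq> []"
  proof -
    interpret bribery_run ?V ?m ?k ?p ?b ?M
    proof
      show "set (?V ! v) = {..<?m} \<and> distinct (?V ! v)" if "v < length ?V" for v
        using V that by simp
      show "(length ?V * (?m - ?k) + ?m * s) *
          ((length ?V * ?m * ?m + 1) * (length ?V * (?m - ?k) + ?m * s + 1) + 1) + 2 \<le> ?M"
        if "s \<le> length ?V" for s
      proof -
        have "length ?V * (?m - ?k) \<le> length ?V * ?m" "?m * s \<le> length ?V * ?m"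
          using that by (simp_all add: mult.commute)
        then have N: "length ?V * (?m - ?k) + ?m * s \<le> 2 * L"
          using nm by linarith
        have "1 * ?m \<le> length ?V * ?m"
          using ne by (intro mult_le_mono1) (simp add: Suc_le_eq)
        then have "?m \<le> L" using nm by linarith
        with nm have big: "length ?V * ?m * ?m \<le> L * L"
          by (rule mult_le_mono)
        show ?thesis
          unfolding iterations_def by (intro add_le_mono mult_le_mono order_refl N big)
      qed
    qed (use k p ne in auto)
    have "input_store ?\<sigma>" using \<sigma> by (simp add: input_store_def)
    from wp_search_prog[OF this] show ?thesis
      by (simp only: swap_bribery_iff_approvable[OF el])
  qed
  have main: "wp ?M (If (Sub num_expr k_expr)
        (If k_expr
          (If persons_expr search_prog (answer_var ::= Const 1))
          (answer_var ::= Const 1))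
        (answer_var ::= Const 1)) ?R ?\<sigma>"
  proof (intro wp_If)
    assume "expr_value (Sub num_expr k_expr) ?\<sigma> \<noteq> 0" "expr_value k_expr ?\<sigma> \<noteq> 0" "expr_value persons_expr ?\<sigma> \<noteq> 0"
    then show "wp ?M search_prog ?R ?\<sigma>" using \<sigma> by (intro search) auto
  next
    assume "expr_value persons_expr ?\<sigma> = 0"
    then show "wp ?M (answer_var ::= Const 1) ?R ?\<sigma>" using \<sigma> p by (intro yes) auto
  next
    assume "expr_value k_expr ?\<sigma> = 0"
    then show "wp ?M (answer_var ::= Const 1) ?R ?\<sigma>" using \<sigma> by (intro yes) auto
  next
    assume "expr_value (Sub num_expr k_expr) ?\<sigma> = 0"
    then show "wp ?M (answer_var ::= Const 1) ?R ?\<sigma>" using \<sigma> by (intro yes) auto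
  qed
  show ?thesis
    unfolding bribery_prog_def
  proof (rule wp_Seq, rule wp_mono[OF main])
    fix \<tau> :: store assume "?R \<tau>"
    then show "wp ?M (0 ::= var answer_var) (\<lambda>\<tau>. accepting \<tau> \<longleftrightarrow> k_approval_unit_swap_bribery I) \<tau>"
      by (intro wp_Write) (simp add: accepting_def k_approval_unit_swap_bribery_def candidates_def)
  qed
qed

theorem theorem1:
  shows "decidable_in_poly_time {I. valid_instance I} encode_instance k_approval_unit_swap_bribery"
proof -
  obtain q :: "nat poly" where q: "\<And>M. poly q M = time_bound bribery_prog M"
    using time_bound_poly by metis
  \<comment> \<open>This polynomial computes \<open>iterations\<close>; substituted into the time
    bound of the program, it makes the running time polynomial in the input size.\<close>
  let ?r = "[:0, 2:] * (([:0, 1:] * [:0, 1:] + [:1:]) * [:1, 2:] + [:1:]) + [:2:] :: nat poly"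
  show ?thesis
    unfolding decidable_in_poly_time_def
  proof (rule exI, rule exI, rule ballI)
    fix I assume "I \<in> {I. valid_instance I}"
    then have "wp (iterations (input_size (encode_instance I))) bribery_prog
        (\<lambda>\<tau>. accepting \<tau> \<longleftrightarrow> k_approval_unit_swap_bribery I) (initial_store (encode_instance I))"
      using wp_bribery_prog length_le_input_size by blast
    moreover have "poly (pcompose q ?r) (input_size (encode_instance I)) =
        time_bound bribery_prog (iterations (input_size (encode_instance I)))"
      by (simp only: poly_pcompose iterations_poly q)
    ultimately show "\<exists>t \<tau>. run bribery_prog (initial_store (encode_instance I)) t \<tau> \<and>
        t \<le> poly (pcompose q ?r) (input_size (encode_instance I)) \<and>
        (accepting \<tau> \<longleftrightarrow> k_approval_unit_swap_bribery I)"
      by (auto simp: wp_def)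
  qed
qed

end
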